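(* Let $L$ be a relational language as in the context. Let $\mathcal{M}$ be the generic structure of the amalgamation class $(\mathcal{C}_0(L),\leq)$ and $\hat{\mathcal{M}}$ the generic structure of the amalgamation class $(\hat{\mathcal{C}}_0(L),\leq)$. Then the geometries $G(\mathcal{M})$ and $G(\hat{\mathcal{M}})$ are isomorphic.
   Context: $L$ consists of relation symbols $(R_i:i\in I)$, $I\neq\emptyset$, $R_i$ of arity $n_i\geq 3$, with only finitely many symbols of each arity. $\mathcal{C}_0(L)$ is the class of finite $L$-structures $A$ in which each $R_i^A$ is a set of $n_i$-element subsets of $A$ (symmetric relations) and $\delta(A')\geq0$ for all $A'\subseteq A$, where $\delta(A)=|A|-\sum_i|R_i^A|$ and substructures are induced. $\hat{\mathcal{C}}_0(L)$ is the class of finite $L$-structures $A$ in which each $R_i^A$ is an arbitrary set of $n_i$-tuples of (not necessarily distinct) elements of $A$, with the predimension again $\delta(A)=|A|-\sum_i|R_i^A|$, and $\delta(A')\geq0$ for all $A'\subseteq A$. In either class, for $A\subseteq B$, $A\leq B$ means $\delta(A)\leq\delta(B')$ for all $A\subseteq B'\subseteq B$; for infinite structures all of whose finite substructures are in the class, $A\leq B$ means $\delta(C)\geq\delta(C\cap A)$ for all finite $C\subseteq B$. For finite $A\subseteq B$, $d_B(A)=\min\{\delta(A'):A\subseteq A'\subseteq B\text{ finite}\}$, ${\rm cl}_B(A)=\{c:d_B(A\cup\{c\})=d_B(A)\}$ (extended to infinite sets by unions over finite subsets); $(B,{\rm cl}_B)$ is a pregeometry with associated geometry $G(B)$ (points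 ${\rm cl}_B(x)\setminus{\rm cl}_B(\emptyset)$ for $x\notin{\rm cl}_B(\emptyset)$, induced closure). Both $(\mathcal{C}_0(L),\leq)$ and $(\hat{\mathcal{C}}_0(L),\leq)$ are amalgamation classes (closed under self-sufficient substructures, and any $A\leq B_1,B_2$ can be amalgamated into some $C$ in the class via embeddings with self-sufficient images agreeing on $A$). The generic structure of such a class is the unique-up-to-isomorphism countable structure, all of whose finite substructures are in the class, which is the union of a chain $A_0\leq A_1\leq\cdots$ of members of the class and such that for every finite $A\leq\mathcal{M}$ and $A\leq B$ in the class there is an embedding of $B$ into $\mathcal{M}$ over $A$ with self-sufficient image. *)

theory Defs
  imports "HOL-Library.Infinite_Typeclass" "HOL-Library.Countable_Set"
begin

text \<open>
  The relation symbols are the elements of a type \<open>'i\<close> with arities \<open>ar :: 'i \<Rightarrow> nat\<close>.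
  The two kinds of structures differ only in what a single instance of a relation is:
  a set of points, or a tuple of points that may have repetitions. A value of the
  following type describes one of these: the points that occur in an instance, the action of
  a map of points on instances, and the instances allowed for a symbol of arity \<open>k\<close>.
\<close>

record ('a, 'e) kind =
  supp :: "'e \<Rightarrow> 'a set"
  emap :: "('a \<Rightarrow> 'a) \<Rightarrow> 'e \<Rightarrow> 'e"
  legal :: "nat \<Rightarrow> 'e \<Rightarrow> bool"

definition subsets_kind :: "('a, 'a set) kind" where
  "subsets_kind = \<lparr>supp = (\<lambda>e. e), emap = (\<lambda>f e. f ` e), legal = (\<lambda>k e. finite e \<and> card e = k)\<rparr>"

definition tuples_kind :: "('a, 'a list) kind" where
  "tuples_kind = \<lparr>supp = set, emap = map, legal = (\<lambda>k e. length e = k)\<rparr>"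

record ('a, 'i, 'e) lstruct =
  univ :: "'a set"
  rels :: "'i \<Rightarrow> 'e set"

definition is_lstruct :: "('a, 'e) kind \<Rightarrow> ('i \<Rightarrow> nat) \<Rightarrow> ('a, 'i, 'e) lstruct \<Rightarrow> bool" where
  "is_lstruct K ar A \<longleftrightarrow>
    (\<forall>i. \<forall>e\<in>rels A i. legal K (ar i) e \<and> supp K e \<subseteq> univ A)"

definition induced :: "('a, 'e) kind \<Rightarrow> ('a, 'i, 'e) lstruct \<Rightarrow> 'a set \<Rightarrow> ('a, 'i, 'e) lstruct" where
  "induced K B X = \<lparr>univ = X, rels = (\<lambda>i. {e \<in> rels B i. supp K e \<subseteq> X})\<rparr>"

definition substruct :: "('a, 'e) kind \<Rightarrow> ('a, 'i, 'e) lstruct \<Rightarrow> ('a, 'i, 'e) lstruct \<Rightarrow> bool" where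
  "substruct K A B \<longleftrightarrow> univ A \<subseteq> univ B \<and> A = induced K B (univ A)"

text \<open>The value is meaningful for a finite universe with finitely many relation instances only.\<close>

definition predim :: "('a, 'i, 'e) lstruct \<Rightarrow> int" where
  "predim A = int (card (univ A)) - (\<Sum>i | rels A i \<noteq> {}. int (card (rels A i)))"

text \<open>
  On a finite universe, a structure of tuples can have infinitely many relation instances, when
  there are symbols of infinitely many arities. Its predimension is then \<open>-\<infinity>\<close>, so it
  is not in the class. As \<^const>\<open>sum\<close> and \<^const>\<open>card\<close> are \<open>0\<close> on
  infinite sets, this has to be excluded explicitly.
\<close>

definition in_class :: "('a, 'e) kind \<Rightarrow> ('i \<Rightarrow> nat) \<Rightarrow> ('a, 'i, 'e) lstruct \<Rightarrow> bool" where
  "in_class K ar A \<longleftrightarrow>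
    finite (univ A) \<and> is_lstruct K ar A \<and> finite (SIGMA i:UNIV. rels A i) \<and>
    (\<forall>X\<subseteq>univ A. 0 \<le> predim (induced K A X))"

definition self_sufficient :: "('a, 'e) kind \<Rightarrow> 'a set \<Rightarrow> ('a, 'i, 'e) lstruct \<Rightarrow> bool" where
  "self_sufficient K X B \<longleftrightarrow> X \<subseteq> univ B \<and>
    (if finite (univ B)
     then \<forall>Y. X \<subseteq> Y \<and> Y \<subseteq> univ B \<longrightarrow> predim (induced K B X) \<le> predim (induced K B Y)
     else \<forall>C. finite C \<and> C \<subseteq> univ B \<longrightarrow> predim (induced K B (C \<inter> X)) \<le> predim (induced K B C))"

definition strong_sub :: "('a, 'e) kind \<Rightarrow> ('a, 'i, 'e) lstruct \<Rightarrow> ('a, 'i, 'e) lstruct \<Rightarrow> bool" where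
  "strong_sub K A B \<longleftrightarrow> substruct K A B \<and> self_sufficient K (univ A) B"

definition embedding ::
  "('a, 'e) kind \<Rightarrow> ('a \<Rightarrow> 'a) \<Rightarrow> ('a, 'i, 'e) lstruct \<Rightarrow> ('a, 'i, 'e) lstruct \<Rightarrow> bool" where
  "embedding K f A B \<longleftrightarrow>
    inj_on f (univ A) \<and> f ` univ A \<subseteq> univ B \<and>
    (\<forall>i e. supp K e \<subseteq> univ A \<longrightarrow> (e \<in> rels A i \<longleftrightarrow> emap K f e \<in> rels B i))"

text \<open>
  The sort constraint makes room in \<open>'a\<close> for a copy over \<open>A\<close> of every finite
  extension of a finite structure \<open>A\<close>, so that the last clause is about all extensions in
  the class. It is no loss of generality, as generic structures are infinite.
\<close>

definition generic ::
  "('a::infinite, 'e) kind \<Rightarrow> ('i \<Rightarrow> nat) \<Rightarrow> ('a, 'i, 'e) lstruct \<Rightarrow> bool" where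
  "generic K ar M \<longleftrightarrow>
    is_lstruct K ar M \<and> countable (univ M) \<and>
    (\<forall>X\<subseteq>univ M. finite X \<longrightarrow> in_class K ar (induced K M X)) \<and>
    (\<exists>A :: nat \<Rightarrow> ('a, 'i, 'e) lstruct.
       (\<forall>n. in_class K ar (A n) \<and> strong_sub K (A n) (A (Suc n))) \<and>
       univ M = (\<Union>n. univ (A n)) \<and> (\<forall>i. rels M i = (\<Union>n. rels (A n) i))) \<and>
    (\<forall>A B. finite (univ A) \<and> strong_sub K A M \<and> in_class K ar B \<and> strong_sub K A B \<longrightarrow>
       (\<exists>f. embedding K f B M \<and> (\<forall>a\<in>univ A. f a = a) \<and> self_sufficient K (f ` univ B) M))"

definition dim :: "('a, 'e) kind \<Rightarrow> ('a, 'i, 'e) lstruct \<Rightarrow> 'a set \<Rightarrow> int" where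
  "dim K B X = (LEAST k. \<exists>Y. X \<subseteq> Y \<and> Y \<subseteq> univ B \<and> finite Y \<and> k = predim (induced K B Y))"

definition cl_fin :: "('a, 'e) kind \<Rightarrow> ('a, 'i, 'e) lstruct \<Rightarrow> 'a set \<Rightarrow> 'a set" where
  "cl_fin K B X = {c \<in> univ B. dim K B (insert c X) = dim K B X}"

definition cl :: "('a, 'e) kind \<Rightarrow> ('a, 'i, 'e) lstruct \<Rightarrow> 'a set \<Rightarrow> 'a set" where
  "cl K B X = (if finite X then cl_fin K B X else (\<Union>Y\<in>{Y. finite Y \<and> Y \<subseteq> X}. cl_fin K B Y))"

record 'p geometry =
  points :: "'p set"
  clos :: "'p set \<Rightarrow> 'p set"

definition geom_points :: "('a, 'e) kind \<Rightarrow> ('a, 'i, 'e) lstruct \<Rightarrow> 'a set set" where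
  "geom_points K B = {cl K B {x} - cl K B {} | x. x \<in> univ B \<and> x \<notin> cl K B {}}"

definition geom :: "('a, 'e) kind \<Rightarrow> ('a, 'i, 'e) lstruct \<Rightarrow> 'a set geometry" where
  "geom K B =
    \<lparr>points = geom_points K B, clos = (\<lambda>P. {p \<in> geom_points K B. p \<subseteq> cl K B (\<Union>P)})\<rparr>"

definition geom_iso :: "'p geometry \<Rightarrow> 'q geometry \<Rightarrow> bool" where
  "geom_iso G H \<longleftrightarrow>
    (\<exists>\<phi>. bij_betw \<phi> (points G) (points H) \<and>
      (\<forall>P\<subseteq>points G. \<phi> ` clos G P = clos H (\<phi> ` P)))"

end

theory Submission
  imports Defs
begin

text \<open>
  The proof is a back-and-forth between the two generic structures along bijections of finite
  self-sufficient subsets that preserve dimension. Dimension only depends on the supports of the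
  relation instances, and replacing the structure on a subset by one with the same dimension
  function does not change the dimension of the whole. An extension in \<open>M\<close> is copied to
  \<open>M_hat\<close> by listing every new set as a tuple. Conversely, an extension in \<open>M_hat\<close> may
  have tuples with repetitions, or several tuples on the same points. It is first enlarged inside
  \<open>M_hat\<close> by auxiliary points: points of dimension 0 for padding, and points parallel to old
  ones. The enlarged structure has the same dimension function as one all of whose new instances
  are distinct sets of the right size.
\<close>

section \<open>Predimension and dimension\<close>

definition edges :: "('a, 'e) kind \<Rightarrow> ('a, 'i, 'e) lstruct \<Rightarrow> 'a set \<Rightarrow> ('i \<times> 'e) set" where
  "edges K B Y = {(i, e). e \<in> rels B i \<and> supp K e \<subseteq> Y}"

definition delta :: "('a, 'e) kind \<Rightarrow> ('a, 'i, 'e) lstruct \<Rightarrow> 'a set \<Rightarrow> int" where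
  "delta K B Y = int (card Y) - int (card (edges K B Y))"

lemma mem_edges: "(i, e) \<in> edges K B Y \<longleftrightarrow> e \<in> rels B i \<and> supp K e \<subseteq> Y"
  by (simp add: edges_def)

lemma edges_mono: "X \<subseteq> Y \<Longrightarrow> edges K B X \<subseteq> edges K B Y"
  by (auto simp: edges_def)

lemma predim_induced:
  assumes "finite (edges K B Y)"
  shows "predim (induced K B Y) = delta K B Y"
proof -
  let ?R = "\<lambda>i. {e \<in> rels B i. supp K e \<subseteq> Y}"
  let ?S = "{i. ?R i \<noteq> {}}"
  have edges: "edges K B Y = Sigma ?S ?R"
    by (auto simp: edges_def)
  have "?S = fst ` edges K B Y"
    by (force simp: edges_def)
  then have "finite ?S"
    using assms by simp
  moreover have "finite (?R i)" for i
    by (rule finite_subset[OF _ finite_imageI[OF assms, of snd]]) (force simp: edges_def)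
  ultimately have "card (edges K B Y) = (\<Sum>i\<in>?S. card (?R i))"
    unfolding edges by (subst card_SigmaI) auto
  then show ?thesis
    by (simp add: predim_def induced_def delta_def)
qed

lemma delta_submodular:
  assumes "finite X" "finite Y" "finite (edges K B (X \<union> Y))"
  shows "delta K B (X \<union> Y) + delta K B (X \<inter> Y) \<le> delta K B X + delta K B Y"
proof -
  have finite: "finite (edges K B X)" "finite (edges K B Y)"
    using assms(3) by (auto intro: finite_subset[OF edges_mono])
  have "card (edges K B X \<union> edges K B Y) \<le> card (edges K B (X \<union> Y))"
    by (rule card_mono[OF assms(3)]) (auto simp: edges_def)
  moreover have "edges K B X \<inter> edges K B Y = edges K B (X \<inter> Y)"
    by (auto simp: edges_def)
  ultimately show ?thesis
    using card_Un_Int[OF assms(1,2)] card_Un_Int[OF finite] by (simp add: delta_def)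
qed

definition nonneg_predim :: "('a, 'e) kind \<Rightarrow> ('a, 'i, 'e) lstruct \<Rightarrow> bool" where
  "nonneg_predim K B \<longleftrightarrow>
    (\<forall>Y\<subseteq>univ B. finite Y \<longrightarrow> finite (edges K B Y) \<and> 0 \<le> delta K B Y)"

lemma nonneg_predimD:
  assumes "nonneg_predim K B" "finite Y" "Y \<subseteq> univ B"
  shows finite_edges: "finite (edges K B Y)" and delta_nonneg: "0 \<le> delta K B Y"
  using assms by (simp_all add: nonneg_predim_def)

lemma predim_induced_eq_delta:
  assumes "nonneg_predim K B" "finite Y" "Y \<subseteq> univ B"
  shows "predim (induced K B Y) = delta K B Y"
  by (rule predim_induced[OF finite_edges[OF assms]])

lemma in_class_iff:
  "in_class K ar B \<longleftrightarrow> finite (univ B) \<and> is_lstruct K ar B \<and> nonneg_predim K B"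
proof (cases "finite (univ B) \<and> is_lstruct K ar B")
  case True
  then have univ: "finite Y" if "Y \<subseteq> univ B" for Y
    using that finite_subset by blast
  have all_edges: "(SIGMA i:UNIV. rels B i) = edges K B (univ B)"
    using True by (auto simp: is_lstruct_def edges_def)
  show ?thesis
  proof (cases "finite (edges K B (univ B))")
    case fin: True
    then have "finite (edges K B Y)" if "Y \<subseteq> univ B" for Y
      using that by (blast intro: finite_subset[OF edges_mono])
    then show ?thesis
      using True fin univ
      by (simp add: in_class_def all_edges nonneg_predim_def predim_induced cong: imp_cong)
  next
    case False
    then show ?thesis
      using True by (auto simp: in_class_def all_edges nonneg_predim_def)
  qed
qed (auto simp: in_class_def)

definition strong_in :: "('a, 'e) kind \<Rightarrow> ('a, 'i, 'e) lstruct \<Rightarrow> 'a set \<Rightarrow> bool" where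
  "strong_in K B X \<longleftrightarrow> finite X \<and> X \<subseteq> univ B \<and>
    (\<forall>Y. finite Y \<and> X \<subseteq> Y \<and> Y \<subseteq> univ B \<longrightarrow> delta K B X \<le> delta K B Y)"

lemma strong_inD:
  assumes "strong_in K B X"
  shows strong_in_finite: "finite X" and strong_in_univ: "X \<subseteq> univ B"
    and delta_le_if_strong_in:
      "\<lbrakk>finite Y; X \<subseteq> Y; Y \<subseteq> univ B\<rbrakk> \<Longrightarrow> delta K B X \<le> delta K B Y"
  using assms by (simp_all add: strong_in_def)

lemma delta_empty: "nonneg_predim K B \<Longrightarrow> delta K B {} = 0"
  using delta_nonneg[of K B "{}"] by (simp add: delta_def)

lemma strong_in_empty: "nonneg_predim K B \<Longrightarrow> strong_in K B {}"
  by (simp add: strong_in_def delta_empty delta_nonneg)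

lemma delta_Int_le_if_strong_in:
  assumes "nonneg_predim K B" "strong_in K B X" "finite C" "C \<subseteq> univ B"
  shows "delta K B (C \<inter> X) \<le> delta K B C"
proof -
  note X = strong_in_finite[OF assms(2)] strong_in_univ[OF assms(2)]
  have "finite (edges K B (C \<union> X))"
    using assms X by (intro finite_edges) auto
  then have "delta K B (C \<union> X) + delta K B (C \<inter> X) \<le> delta K B C + delta K B X"
    using assms X by (intro delta_submodular) auto
  moreover have "delta K B X \<le> delta K B (C \<union> X)"
    using assms X by (intro delta_le_if_strong_in) auto
  ultimately show ?thesis by simp
qed

lemma strong_in_iff_delta_Int_le:
  assumes "nonneg_predim K B" "finite X"
  shows "strong_in K B X \<longleftrightarrow> X \<subseteq> univ B \<and>
    (\<forall>C. finite C \<and> C \<subseteq> univ B \<longrightarrow> delta K B (C \<inter> X) \<le> delta K B C)"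
proof
  assume "X \<subseteq> univ B \<and> (\<forall>C. finite C \<and> C \<subseteq> univ B \<longrightarrow> delta K B (C \<inter> X) \<le> delta K B C)"
  then show "strong_in K B X"
    using assms(2) by (auto simp: strong_in_def Int_absorb1)
qed (use delta_Int_le_if_strong_in[OF assms(1)] strong_in_univ in blast)

lemma self_sufficient_iff_strong_in:
  assumes "nonneg_predim K B" "finite X"
  shows "self_sufficient K X B \<longleftrightarrow> strong_in K B X"
proof (cases "finite (univ B)")
  case True
  then have "finite Y" if "Y \<subseteq> univ B" for Y
    using that finite_subset by blast
  then show ?thesis
    unfolding self_sufficient_def strong_in_def
    using True assms by (auto simp: predim_induced_eq_delta)
next
  case False
  then show ?thesis
    unfolding self_sufficient_def strong_in_iff_delta_Int_le[OF assms]
    using assms(1) by (simp add: predim_induced_eq_delta le_infI1 cong: conj_cong imp_cong)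
qed

lemma dim_attained:
  assumes "nonneg_predim K B" "finite X" "X \<subseteq> univ B"
  obtains Y where "strong_in K B Y" "X \<subseteq> Y" "dim K B X = delta K B Y"
    "\<And>Z. \<lbrakk>finite Z; X \<subseteq> Z; Z \<subseteq> univ B\<rbrakk> \<Longrightarrow> delta K B Y \<le> delta K B Z"
proof -
  let ?above = "\<lambda>Y. finite Y \<and> X \<subseteq> Y \<and> Y \<subseteq> univ B"
  have "?above X"
    using assms by simp
  then have "\<exists>Y. ?above Y \<and> (\<forall>Z. ?above Z \<longrightarrow> nat (delta K B Y) \<le> nat (delta K B Z))"
    by (rule ex_has_least_nat)
  then obtain Y where Y: "finite Y" "X \<subseteq> Y" "Y \<subseteq> univ B"
    and nat_least: "\<And>Z. ?above Z \<Longrightarrow> nat (delta K B Y) \<le> nat (delta K B Z)"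
    by auto
  have least: "delta K B Y \<le> delta K B Z" if "finite Z" "X \<subseteq> Z" "Z \<subseteq> univ B" for Z
    using nat_least[of Z] delta_nonneg[OF assms(1), of Z] that by (simp add: nat_le_iff)
  have "dim K B X = delta K B Y"
    unfolding dim_def
  proof (rule Least_equality)
    show "\<exists>Z. X \<subseteq> Z \<and> Z \<subseteq> univ B \<and> finite Z \<and> delta K B Y = predim (induced K B Z)"
      using Y by (intro exI[of _ Y]) (simp add: predim_induced_eq_delta[OF assms(1)])
  next
    fix k
    assume "\<exists>Z. X \<subseteq> Z \<and> Z \<subseteq> univ B \<and> finite Z \<and> k = predim (induced K B Z)"
    then obtain Z where "X \<subseteq> Z" "Z \<subseteq> univ B" "finite Z" "k = predim (induced K B Z)"
      by (elim exE conjE)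
    then show "delta K B Y \<le> k"
      using least by (simp add: predim_induced_eq_delta[OF assms(1)])
  qed
  moreover have "strong_in K B Y"
    using Y least order_trans[of X Y] by (simp add: strong_in_def)
  ultimately show ?thesis
    using Y least by (intro that[of Y]) simp_all
qed

lemma dim_le_delta:
  assumes "nonneg_predim K B" "finite Y" "X \<subseteq> Y" "Y \<subseteq> univ B"
  shows "dim K B X \<le> delta K B Y"
proof -
  have "finite X" "X \<subseteq> univ B"
    using assms finite_subset by auto
  then obtain Z where "dim K B X = delta K B Z"
    "\<And>Y. \<lbrakk>finite Y; X \<subseteq> Y; Y \<subseteq> univ B\<rbrakk> \<Longrightarrow> delta K B Z \<le> delta K B Y"
    by (rule dim_attained[OF assms(1)]) blast
  then show ?thesis
    using assms(2-4) by simp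
qed

lemma dim_empty:
  assumes "nonneg_predim K B"
  shows "dim K B {} = 0"
proof -
  obtain Y where "strong_in K B Y" "dim K B {} = delta K B Y"
    by (rule dim_attained[OF assms finite.emptyI empty_subsetI])
  then have "0 \<le> dim K B {}"
    using delta_nonneg[OF assms] strong_inD by metis
  moreover have "dim K B {} \<le> 0"
    using dim_le_delta[OF assms, of "{}" "{}"] delta_empty[OF assms] by simp
  ultimately show ?thesis by simp
qed

lemma exists_strong_in_superset:
  assumes "nonneg_predim K B" "finite X" "X \<subseteq> univ B"
  obtains Y where "strong_in K B Y" "X \<subseteq> Y"
  by (rule dim_attained[OF assms]) (rule that)

section \<open>Set functions and their dimension functions\<close>

definition dim_on :: "'v set \<Rightarrow> ('v set \<Rightarrow> int) \<Rightarrow> 'v set \<Rightarrow> int" where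
  "dim_on V \<alpha> X = (MIN Z\<in>{X..V}. \<alpha> Z)"

lemma finite_set_interval: "finite V \<Longrightarrow> finite {X..V}" for V :: "'v set"
  by (rule finite_subset[of _ "Pow V"]) auto

lemma dim_on_le:
  assumes "finite V" "X \<subseteq> Z" "Z \<subseteq> V"
  shows "dim_on V \<alpha> X \<le> \<alpha> Z"
  unfolding dim_on_def by (rule Min_le) (use assms in \<open>simp_all add: finite_set_interval\<close>)

lemma dim_on_attained:
  assumes "finite V" "X \<subseteq> V"
  obtains Z where "X \<subseteq> Z" "Z \<subseteq> V" "dim_on V \<alpha> X = \<alpha> Z"
proof -
  have "dim_on V \<alpha> X \<in> \<alpha> ` {X..V}"
    unfolding dim_on_def by (rule Min_in) (use assms in \<open>simp_all add: finite_set_interval\<close>)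
  then obtain Z where "dim_on V \<alpha> X = \<alpha> Z" "Z \<in> {X..V}"
    by (rule imageE)
  then show ?thesis
    by (intro that[of Z]) simp_all
qed

lemma dim_on_cong:
  assumes "\<And>Z. Z \<subseteq> V \<Longrightarrow> \<alpha> Z = \<beta> Z"
  shows "dim_on V \<alpha> = dim_on V \<beta>"
proof
  fix X
  have "\<alpha> ` {X..V} = \<beta> ` {X..V}"
    using assms by (intro image_cong) auto
  then show "dim_on V \<alpha> X = dim_on V \<beta> X"
    by (simp add: dim_on_def)
qed

lemma dim_on_eqI:
  assumes "\<And>X. X \<subseteq> V \<Longrightarrow> dim_on V \<alpha> X = dim_on V \<beta> X"
  shows "dim_on V \<alpha> = dim_on V \<beta>"
proof
  fix X
  show "dim_on V \<alpha> X = dim_on V \<beta> X"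
    \<comment> \<open>if \<open>X\<close> is not included in \<open>V\<close>, then both sides are the minimum of the empty set\<close>
    using assms by (cases "X \<subseteq> V") (simp_all add: dim_on_def)
qed

definition saturated :: "'v set \<Rightarrow> ('v set \<Rightarrow> int) \<Rightarrow> 'v set \<Rightarrow> bool" where
  "saturated V \<alpha> Z \<longleftrightarrow> Z \<subseteq> V \<and> (\<forall>Y. Z \<subseteq> Y \<and> Y \<subseteq> V \<and> \<alpha> Y \<le> \<alpha> Z \<longrightarrow> Y = Z)"

lemma exists_saturated_superset:
  assumes "finite V" "X \<subseteq> V"
  obtains Z where "saturated V \<alpha> Z" "X \<subseteq> Z" "\<alpha> Z \<le> \<alpha> X"
proof -
  let ?S = "{Z \<in> {X..V}. \<alpha> Z \<le> \<alpha> X}"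
  have "finite ?S" "?S \<noteq> {}"
    using assms by (auto simp: finite_set_interval)
  then have "\<exists>Z\<in>?S. \<forall>Y\<in>?S. Z \<subseteq> Y \<longrightarrow> Z = Y"
    by (rule finite_has_maximal)
  then obtain Z where Z: "Z \<in> ?S" and maximal: "\<And>Y. \<lbrakk>Y \<in> ?S; Z \<subseteq> Y\<rbrakk> \<Longrightarrow> Z = Y"
    by blast
  have "Y = Z" if "Z \<subseteq> Y" "Y \<subseteq> V" "\<alpha> Y \<le> \<alpha> Z" for Y
    using that Z by (intro maximal[symmetric]) auto
  then show ?thesis
    using Z by (intro that[of Z]) (auto simp: saturated_def)
qed

lemma dim_on_le_if_saturated_le:
  assumes "finite V" "X \<subseteq> V" and le: "\<And>Z. saturated V \<alpha> Z \<Longrightarrow> \<beta> Z \<le> \<alpha> Z"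
  shows "dim_on V \<beta> X \<le> dim_on V \<alpha> X"
proof -
  obtain Y where Y: "X \<subseteq> Y" "Y \<subseteq> V" "dim_on V \<alpha> X = \<alpha> Y"
    by (rule dim_on_attained[OF assms(1,2)])
  obtain Z where Z: "saturated V \<alpha> Z" "Y \<subseteq> Z" "\<alpha> Z \<le> \<alpha> Y"
    by (rule exists_saturated_superset[OF assms(1) Y(2)])
  have "dim_on V \<beta> X \<le> \<beta> Z"
    using assms(1) Y(1) Z(1,2) by (intro dim_on_le) (auto simp: saturated_def)
  also have "\<dots> \<le> \<alpha> Z"
    using Z(1) by (rule le)
  finally show ?thesis
    using Y(3) Z(3) by simp
qed

lemma dim_on_eq_if_saturated_eq:
  assumes "finite V" "\<And>Z. saturated V \<alpha> Z \<or> saturated V \<beta> Z \<Longrightarrow> \<alpha> Z = \<beta> Z"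
  shows "dim_on V \<alpha> = dim_on V \<beta>"
  by (intro dim_on_eqI antisym dim_on_le_if_saturated_le assms(1)) (simp_all add: assms(2))

lemma dim_image_eq_dim_on:
  assumes "nonneg_predim K M" "strong_in K M (m ` V)" "finite V" "X \<subseteq> V"
  shows "dim K M (m ` X) = dim_on V (\<lambda>Z. delta K M (m ` Z)) X"
proof (rule antisym)
  obtain Z where Z: "X \<subseteq> Z" "Z \<subseteq> V"
    "dim_on V (\<lambda>Z. delta K M (m ` Z)) X = delta K M (m ` Z)"
    by (rule dim_on_attained[OF assms(3,4)])
  have "m ` Z \<subseteq> univ M" "finite (m ` Z)"
    using Z(2) strong_in_univ[OF assms(2)] finite_subset[OF Z(2) assms(3)] by auto
  then show "dim K M (m ` X) \<le> dim_on V (\<lambda>Z. delta K M (m ` Z)) X"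
    using Z by (simp add: dim_le_delta[OF assms(1)] image_mono)
next
  have "finite (m ` X)" "m ` X \<subseteq> univ M"
    using assms(4) strong_in_univ[OF assms(2)] finite_subset[OF assms(4,3)] by auto
  then obtain Y where Y: "strong_in K M Y" "m ` X \<subseteq> Y" "dim K M (m ` X) = delta K M Y"
    by (rule dim_attained[OF assms(1)])
  have "m ` {v \<in> V. m v \<in> Y} = Y \<inter> m ` V"
    by auto
  moreover have "delta K M (Y \<inter> m ` V) \<le> delta K M Y"
    using strong_in_finite[OF Y(1)] strong_in_univ[OF Y(1)]
    by (rule delta_Int_le_if_strong_in[OF assms(1,2)])
  moreover have "dim_on V (\<lambda>Z. delta K M (m ` Z)) X \<le> delta K M (m ` {v \<in> V. m v \<in> Y})"
    using assms(3,4) Y(2) by (intro dim_on_le) auto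
  ultimately show "dim_on V (\<lambda>Z. delta K M (m ` Z)) X \<le> dim K M (m ` X)"
    using Y(3) by simp
qed

lemma dim_on_delta_eq_iff:
  assumes "nonneg_predim K M" "nonneg_predim L N"
    and "strong_in K M (m ` V)" "strong_in L N (n ` V)" "finite V"
  shows "dim_on V (\<lambda>X. delta K M (m ` X)) = dim_on V (\<lambda>X. delta L N (n ` X)) \<longleftrightarrow>
    (\<forall>X\<subseteq>V. dim K M (m ` X) = dim L N (n ` X))"
    (is "?eq \<longleftrightarrow> ?dim_eq")
proof
  assume ?eq
  then show ?dim_eq
    by (simp add: dim_image_eq_dim_on[OF assms(1,3,5)] dim_image_eq_dim_on[OF assms(2,4,5)])
next
  assume ?dim_eq
  then show ?eq
    by (intro dim_on_eqI)
      (simp add: dim_image_eq_dim_on[OF assms(1,3,5)] dim_image_eq_dim_on[OF assms(2,4,5)])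
qed

section \<open>Adding vertices and edges to a base\<close>

text \<open>
  The base \<open>W\<close> carries the predimension \<open>\<alpha>\<close>; the edges added to it are indexed by \<open>J\<close>, and \<open>s j\<close> is
  the set of vertices of the edge \<open>j\<close>.
\<close>

definition ext_delta ::
  "'v set \<Rightarrow> ('v set \<Rightarrow> int) \<Rightarrow> ('j \<Rightarrow> 'v set) \<Rightarrow> 'j set \<Rightarrow> 'v set \<Rightarrow> int" where
  "ext_delta W \<alpha> s J Y = \<alpha> (Y \<inter> W) + int (card (Y - W)) - int (card {j \<in> J. s j \<subseteq> Y})"

lemma inj_on_image_subset_iff:
  assumes "inj_on g V" "X \<subseteq> V" "Y \<subseteq> V"
  shows "g ` X \<subseteq> g ` Y \<longleftrightarrow> X \<subseteq> Y"
  unfolding image_subset_iff using inj_on_image_mem_iff[OF assms(1) _ assms(3)] assms(2) by blast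

lemma ext_delta_cong_base:
  assumes "\<And>X. X \<subseteq> W \<Longrightarrow> \<alpha> X = \<beta> X"
  shows "ext_delta W \<alpha> s J = ext_delta W \<beta> s J"
  by (simp add: ext_delta_def assms fun_eq_iff)

lemma ext_delta_image_edges:
  assumes "inj_on \<phi> J"
  shows "ext_delta W \<alpha> t (\<phi> ` J) = ext_delta W \<alpha> (\<lambda>j. t (\<phi> j)) J"
proof
  fix Y
  have "{j \<in> \<phi> ` J. t j \<subseteq> Y} = \<phi> ` {j \<in> J. t (\<phi> j) \<subseteq> Y}"
    by auto
  moreover have "card (\<phi> ` {j \<in> J. t (\<phi> j) \<subseteq> Y}) = card {j \<in> J. t (\<phi> j) \<subseteq> Y}"
    by (intro card_image inj_on_subset[OF assms]) auto
  ultimately show "ext_delta W \<alpha> t (\<phi> ` J) Y = ext_delta W \<alpha> (\<lambda>j. t (\<phi> j)) J Y"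
    by (simp add: ext_delta_def)
qed

lemma ext_delta_image:
  assumes "inj_on g V" "W \<subseteq> V" "Y \<subseteq> V" "inj_on \<phi> J"
    and supp: "\<And>j. j \<in> J \<Longrightarrow> s j \<subseteq> V \<and> t (\<phi> j) = g ` s j"
  shows "ext_delta (g ` W) \<alpha> t (\<phi> ` J) (g ` Y) = ext_delta W (\<lambda>X. \<alpha> (g ` X)) s J Y"
proof -
  have "t (\<phi> j) \<subseteq> g ` Y \<longleftrightarrow> s j \<subseteq> Y" if "j \<in> J" for j
    using supp[OF that] assms(1,3) by (simp add: inj_on_image_subset_iff)
  then have "{j \<in> J. t (\<phi> j) \<subseteq> g ` Y} = {j \<in> J. s j \<subseteq> Y}"
    by auto
  moreover have "card (g ` Y - g ` W) = card (Y - W)"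
    using assms(1-3) by (subst inj_on_image_set_diff[symmetric])
      (auto intro!: card_image intro: inj_on_subset)
  ultimately show ?thesis
    using assms(1-3)
    by (simp add: ext_delta_image_edges[OF assms(4)] ext_delta_def inj_on_image_Int)
qed

lemma ext_delta_trans:
  assumes "finite Y" "U \<subseteq> W" "finite I" "finite J" "I \<inter> J = {}"
    and "\<And>i. i \<in> I \<Longrightarrow> s i \<subseteq> W"
  shows "ext_delta W (ext_delta U \<alpha> s I) s J Y = ext_delta U \<alpha> s (I \<union> J) Y"
proof -
  have "card (Y - U) = card ((Y - W) \<union> (Y \<inter> W - U))"
    using assms(2) by (intro arg_cong[where f = card]) auto
  also have "\<dots> = card (Y - W) + card (Y \<inter> W - U)"
    using assms(1) by (intro card_Un_disjoint) auto
  finally have "card (Y - U) = card (Y - W) + card (Y \<inter> W - U)" .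
  moreover have "{i \<in> I. s i \<subseteq> Y \<inter> W} = {i \<in> I. s i \<subseteq> Y}"
    using assms(6) by auto
  moreover have "card {j \<in> I \<union> J. s j \<subseteq> Y} = card {i \<in> I. s i \<subseteq> Y} + card {j \<in> J. s j \<subseteq> Y}"
    using assms(3-5) by (subst card_Un_disjoint[symmetric]) (auto intro: arg_cong[where f = card])
  moreover have "Y \<inter> W \<inter> U = Y \<inter> U"
    using assms(2) by auto
  ultimately show ?thesis
    by (simp add: ext_delta_def)
qed

lemma dim_on_ext_delta_le:
  assumes "finite V" "W \<subseteq> V" "finite J" "X \<subseteq> V" and eq: "dim_on W \<alpha> = dim_on W \<beta>"
  shows "dim_on V (ext_delta W \<beta> s J) X \<le> dim_on V (ext_delta W \<alpha> s J) X"
proof -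
  obtain Y where Y: "X \<subseteq> Y" "Y \<subseteq> V" "dim_on V (ext_delta W \<alpha> s J) X = ext_delta W \<alpha> s J Y"
    by (rule dim_on_attained[OF assms(1,4)])
  have "finite W"
    using assms(1,2) finite_subset by blast
  then obtain Z where Z: "Y \<inter> W \<subseteq> Z" "Z \<subseteq> W" "dim_on W \<beta> (Y \<inter> W) = \<beta> Z"
    using Int_lower2 by (rule dim_on_attained)
  have base: "(Y \<union> Z) \<inter> W = Z" "Y \<union> Z - W = Y - W"
    using Z by auto
  have "\<beta> Z \<le> \<alpha> (Y \<inter> W)"
    using dim_on_le[OF \<open>finite W\<close> order_refl, of "Y \<inter> W" \<alpha>] Z(3) by (simp add: eq)
  moreover have "card {j \<in> J. s j \<subseteq> Y} \<le> card {j \<in> J. s j \<subseteq> Y \<union> Z}"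
    using assms(3) by (intro card_mono) auto
  ultimately have "ext_delta W \<beta> s J (Y \<union> Z) \<le> ext_delta W \<alpha> s J Y"
    by (simp add: ext_delta_def base)
  moreover have "dim_on V (ext_delta W \<beta> s J) X \<le> ext_delta W \<beta> s J (Y \<union> Z)"
    using assms(1,2) Y(1,2) Z(2) by (intro dim_on_le) auto
  ultimately show ?thesis
    using Y(3) by simp
qed

lemma dim_on_ext_delta_cong:
  assumes "finite V" "W \<subseteq> V" "finite J" "dim_on W \<alpha> = dim_on W \<beta>"
  shows "dim_on V (ext_delta W \<alpha> s J) = dim_on V (ext_delta W \<beta> s J)"
  by (intro dim_on_eqI antisym dim_on_ext_delta_le assms assms(4)[symmetric])

text \<open>The injection \<open>\<tau>\<close> charges every vertex that is new to \<open>Y\<close> to an edge that is new to \<open>Y\<close>.\<close>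

lemma ext_delta_Un_le:
  assumes "finite Y" "finite I" "finite J" "x ` I \<inter> W = {}" "inj_on \<tau> I"
    and \<tau>: "\<And>i. i \<in> I \<Longrightarrow> \<tau> i \<in> J \<and> x i \<in> s (\<tau> i) \<and> s (\<tau> i) \<subseteq> Y \<union> x ` I"
  shows "ext_delta W \<alpha> s J (Y \<union> x ` I) \<le> ext_delta W \<alpha> s J Y"
proof -
  let ?I = "{i \<in> I. x i \<notin> Y}"
  have new: "(Y \<union> x ` I) \<inter> W = Y \<inter> W" "Y \<union> x ` I - W = (Y - W) \<union> x ` ?I"
    using assms(4) by auto
  have "card (x ` ?I) \<le> card (\<tau> ` ?I)"
    using assms(2,5) card_image_le[of ?I x] card_image[of \<tau> ?I] inj_on_subset[of \<tau> I ?I] by simp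
  moreover have "card {j \<in> J. s j \<subseteq> Y} + card (\<tau> ` ?I) = card ({j \<in> J. s j \<subseteq> Y} \<union> \<tau> ` ?I)"
    using assms(2,3) \<tau> by (intro card_Un_disjoint[symmetric]) auto
  moreover have "\<dots> \<le> card {j \<in> J. s j \<subseteq> Y \<union> x ` I}"
    using assms(3) \<tau> by (intro card_mono) auto
  moreover have "card ((Y - W) \<union> x ` ?I) \<le> card (Y - W) + card (x ` ?I)"
    by (rule card_Un_le)
  ultimately show ?thesis
    by (simp add: ext_delta_def new)
qed

lemma saturated_image_subset:
  assumes sat: "saturated V (ext_delta W \<alpha> s J) Z" and "finite V" "finite I" "finite J"
    and "x ` I \<subseteq> V - W" "inj_on \<tau> I"
    and \<tau>: "\<And>i. i \<in> I \<Longrightarrow> \<tau> i \<in> J \<and> x i \<in> s (\<tau> i) \<and> s (\<tau> i) \<subseteq> Z \<union> x ` I"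
  shows "x ` I \<subseteq> Z"
proof -
  have Z: "Z \<subseteq> V"
    using sat by (simp add: saturated_def)
  then have "ext_delta W \<alpha> s J (Z \<union> x ` I) \<le> ext_delta W \<alpha> s J Z"
    using assms finite_subset by (intro ext_delta_Un_le[where \<tau> = \<tau>]) auto
  then have "Z \<union> x ` I = Z"
    using sat Z assms(5) by (auto simp: saturated_def)
  then show ?thesis by blast
qed

lemma saturated_memI:
  assumes "saturated V (ext_delta W \<alpha> s J) Z" "finite V" "finite J"
    and "v \<in> V - W" "j \<in> J" "v \<in> s j" "s j \<subseteq> insert v Z"
  shows "v \<in> Z"
  using saturated_image_subset[where I = "{j}" and x = "\<lambda>_. v" and \<tau> = "\<lambda>j. j",
      OF assms(1,2) _ assms(3)] assms(4-)
  by auto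

lemma dim_on_ext_delta_eq_if_saturated:
  assumes "finite V"
    and "\<And>Z j. saturated V (ext_delta W \<alpha> s J) Z \<or> saturated V (ext_delta W \<alpha> t J) Z \<Longrightarrow>
      j \<in> J \<Longrightarrow> s j \<subseteq> Z \<longleftrightarrow> t j \<subseteq> Z"
  shows "dim_on V (ext_delta W \<alpha> s J) = dim_on V (ext_delta W \<alpha> t J)"
proof (rule dim_on_eq_if_saturated_eq[OF assms(1)])
  fix Z
  assume "saturated V (ext_delta W \<alpha> s J) Z \<or> saturated V (ext_delta W \<alpha> t J) Z"
  then have "{j \<in> J. s j \<subseteq> Z} = {j \<in> J. t j \<subseteq> Z}"
    using assms(2) by auto
  then show "ext_delta W \<alpha> s J Z = ext_delta W \<alpha> t J Z"
    by (simp add: ext_delta_def)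
qed

locale edge_extension =
  fixes V W :: "'v set" and s :: "'j \<Rightarrow> 'v set" and J :: "'j set"
  assumes finite_V: "finite V" and W_subset_V: "W \<subseteq> V" and finite_J: "finite J"
    and supp_subset_V: "j \<in> J \<Longrightarrow> s j \<subseteq> V" and supp_not_subset_W: "j \<in> J \<Longrightarrow> \<not> s j \<subseteq> W"

text \<open>
  This says that \<open>W\<close> is self-sufficient in \<open>V\<close> with respect to \<open>ext_delta W \<alpha> s J\<close>, for every \<open>\<alpha>\<close>.
\<close>

definition strong_extension :: "'v set \<Rightarrow> 'v set \<Rightarrow> ('j \<Rightarrow> 'v set) \<Rightarrow> 'j set \<Rightarrow> bool" where
  "strong_extension V W s J \<longleftrightarrow>
    (\<forall>Y. W \<subseteq> Y \<and> Y \<subseteq> V \<longrightarrow> card {j \<in> J. s j \<subseteq> Y} \<le> card (Y - W))"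

lemma ext_delta_ge_base:
  assumes "strong_extension V W s J" "W \<subseteq> V" "finite J" "Y \<subseteq> V"
  shows "\<alpha> (Y \<inter> W) \<le> ext_delta W \<alpha> s J Y"
proof -
  have "card {j \<in> J. s j \<subseteq> Y} \<le> card {j \<in> J. s j \<subseteq> Y \<union> W}"
    using assms(3) by (intro card_mono) auto
  also have "\<dots> \<le> card (Y \<union> W - W)"
    using assms(1,2,4) by (simp add: strong_extension_def)
  also have "Y \<union> W - W = Y - W"
    by auto
  finally show ?thesis
    by (simp add: ext_delta_def)
qed

lemma strong_extensionI:
  assumes "\<And>Y. \<lbrakk>W \<subseteq> Y; Y \<subseteq> V\<rbrakk> \<Longrightarrow> \<alpha> W \<le> ext_delta W \<alpha> s J Y"
  shows "strong_extension V W s J"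
  using assms by (simp add: strong_extension_def ext_delta_def Int_absorb1)

lemma strong_extension_if_dim_on_eq:
  assumes "finite V" "dim_on V \<beta> = dim_on V (ext_delta W \<alpha> s J)"
    and "\<And>Z. \<lbrakk>W \<subseteq> Z; Z \<subseteq> V\<rbrakk> \<Longrightarrow> \<alpha> W \<le> \<beta> Z"
  shows "strong_extension V W s J"
proof (rule strong_extensionI)
  fix Y assume Y: "W \<subseteq> Y" "Y \<subseteq> V"
  obtain Z where Z: "Y \<subseteq> Z" "Z \<subseteq> V" "dim_on V \<beta> Y = \<beta> Z"
    by (rule dim_on_attained[OF assms(1) Y(2)])
  have "\<alpha> W \<le> \<beta> Z"
    using Y(1) Z(1,2) by (intro assms(3)) auto
  also have "\<dots> = dim_on V (ext_delta W \<alpha> s J) Y"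
    by (simp add: Z(3) flip: assms(2))
  also have "\<dots> \<le> ext_delta W \<alpha> s J Y"
    using assms(1) order_refl Y(2) by (rule dim_on_le)
  finally show "\<alpha> W \<le> ext_delta W \<alpha> s J Y" .
qed

lemma strong_extension_image:
  assumes "strong_extension V W s J" "W \<subseteq> V" "finite J" "inj_on g V" "inj_on \<phi> J"
    and "\<And>j. j \<in> J \<Longrightarrow> s j \<subseteq> V \<and> t (\<phi> j) = g ` s j"
  shows "strong_extension (g ` V) (g ` W) t (\<phi> ` J)"
proof (rule strong_extensionI[where \<alpha> = "\<lambda>_. 0"])
  fix Y assume "Y \<subseteq> g ` V"
  then obtain X where X: "X \<subseteq> V" "Y = g ` X"
    by (rule subset_imageE)
  have "0 \<le> ext_delta W (\<lambda>_. 0) s J X"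
    by (rule ext_delta_ge_base[OF assms(1-3) X(1)])
  also have "\<dots> = ext_delta (g ` W) (\<lambda>_. 0) t (\<phi> ` J) Y"
    unfolding X(2) using assms(6) by (intro ext_delta_image[OF assms(4,2) X(1) assms(5), symmetric])
  finally show "0 \<le> ext_delta (g ` W) (\<lambda>_. 0) t (\<phi> ` J) Y" .
qed

lemma ext_delta_base:
  assumes "Y \<subseteq> W" "\<And>j. j \<in> J \<Longrightarrow> \<not> s j \<subseteq> W"
  shows "ext_delta W \<alpha> s J Y = \<alpha> Y"
proof -
  have no_edges: "{j \<in> J. s j \<subseteq> Y} = {}"
    using assms by blast
  show ?thesis
    using assms(1) by (simp add: ext_delta_def no_edges Int_absorb2 Diff_eq_empty_iff[THEN iffD2])
qed

lemma delta_eq_ext_delta: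
  assumes "edges K B Y = edges K N (Y \<inter> A) \<union> {j \<in> J. supp K (snd j) \<subseteq> Y}"
    and "finite Y" "finite J" "finite (edges K N (Y \<inter> A))"
    and new: "\<And>j. j \<in> J \<Longrightarrow> \<not> supp K (snd j) \<subseteq> A"
  shows "delta K B Y = ext_delta A (delta K N) (\<lambda>j. supp K (snd j)) J Y"
proof -
  have "edges K N (Y \<inter> A) \<inter> {j \<in> J. supp K (snd j) \<subseteq> Y} = {}"
    using new by (force simp: edges_def)
  then have "card (edges K B Y)
      = card (edges K N (Y \<inter> A)) + card {j \<in> J. supp K (snd j) \<subseteq> Y}"
    unfolding assms(1) using assms(3,4) by (intro card_Un_disjoint) auto
  then show ?thesis
    using card_Int_Diff[OF assms(2), of A] by (simp add: delta_def ext_delta_def)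
qed

lemma delta_eq_ext_delta_subset:
  assumes "nonneg_predim K N" "finite B" "B \<subseteq> univ N" "A \<subseteq> B" "Y \<subseteq> B"
  shows "delta K N Y
    = ext_delta A (delta K N) (\<lambda>j. supp K (snd j)) (edges K N B - edges K N A) Y"
proof (rule delta_eq_ext_delta)
  show "edges K N Y
      = edges K N (Y \<inter> A) \<union> {j \<in> edges K N B - edges K N A. supp K (snd j) \<subseteq> Y}"
    using assms(5) by (auto simp: edges_def)
  have fin: "finite (edges K N B)"
    using assms(1-3) by (rule finite_edges)
  then show "finite (edges K N B - edges K N A)"
    by simp
  show "finite (edges K N (Y \<inter> A))"
    by (rule finite_subset[OF edges_mono fin]) (use assms(5) in auto)
qed (use assms(2,5) finite_subset in \<open>auto simp: edges_def\<close>)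

lemma edge_extension_edges:
  assumes "nonneg_predim K N" "finite B" "B \<subseteq> univ N" "A \<subseteq> B"
  shows "edge_extension B A (\<lambda>j. supp K (snd j)) (edges K N B - edges K N A)"
  using assms finite_edges[OF assms(1-3)] by unfold_locales (auto simp: edges_def)

section \<open>Free extensions inside a generic structure\<close>

lemma generic_in_class:
  assumes "generic K ar M" "X \<subseteq> univ M" "finite X"
  shows "in_class K ar (induced K M X)"
proof -
  have "\<forall>X\<subseteq>univ M. finite X \<longrightarrow> in_class K ar (induced K M X)"
    using assms(1) unfolding generic_def by (elim conjE) assumption
  then show ?thesis
    using assms(2,3) by simp
qed

lemma generic_legal:
  assumes "generic K ar M" "e \<in> rels M i"
  shows "legal K (ar i) e"
  using assms by (simp add: generic_def is_lstruct_def)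

lemma generic_nonneg_predim:
  assumes "generic K ar M"
  shows "nonneg_predim K M"
  unfolding nonneg_predim_def
proof (intro allI impI)
  fix Y assume "Y \<subseteq> univ M" "finite Y"
  then have "nonneg_predim K (induced K M Y)"
    using generic_in_class[OF assms] by (simp add: in_class_iff)
  then have "finite (edges K (induced K M Y) Y)" "0 \<le> delta K (induced K M Y) Y"
    using \<open>finite Y\<close> by (simp_all add: nonneg_predimD induced_def)
  moreover have "edges K (induced K M Y) Y = edges K M Y"
    by (auto simp: induced_def edges_def)
  ultimately show "finite (edges K M Y) \<and> 0 \<le> delta K M Y"
    by (simp add: delta_def)
qed

lemma generic_embedding:
  assumes "generic K ar M" "finite (univ A)" "strong_sub K A M" "in_class K ar B" "strong_sub K A B"
  obtains f where "embedding K f B M" "\<And>a. a \<in> univ A \<Longrightarrow> f a = a"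
    "self_sufficient K (f ` univ B) M"
proof -
  have "\<forall>A B. finite (univ A) \<and> strong_sub K A M \<and> in_class K ar B \<and> strong_sub K A B \<longrightarrow>
      (\<exists>f. embedding K f B M \<and> (\<forall>a\<in>univ A. f a = a) \<and> self_sufficient K (f ` univ B) M)"
    using assms(1) unfolding generic_def by (elim conjE) assumption
  then have "\<exists>f. embedding K f B M \<and> (\<forall>a\<in>univ A. f a = a) \<and> self_sufficient K (f ` univ B) M"
    using assms(2-5) by simp
  then show ?thesis
    using that by (elim exE conjE) simp
qed

locale kind_laws =
  fixes K :: "('a::infinite, 'e) kind"
  assumes supp_emap: "supp K (emap K f e) = f ` supp K e"
    and emap_inj: "\<lbrakk>inj_on f S; supp K e \<subseteq> S; supp K e' \<subseteq> S; emap K f e = emap K f e'\<rbrakk> \<Longrightarrow> e = e'"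
    and emap_surj: "supp K e \<subseteq> f ` S \<Longrightarrow> \<exists>e'. supp K e' \<subseteq> S \<and> emap K f e' = e"

interpretation subsets: kind_laws subsets_kind
proof
  fix f :: "'a \<Rightarrow> 'a" and S e e'
  show "supp subsets_kind (emap subsets_kind f e) = f ` supp subsets_kind e"
    by (simp add: subsets_kind_def)
  show "\<lbrakk>inj_on f S; supp subsets_kind e \<subseteq> S; supp subsets_kind e' \<subseteq> S;
      emap subsets_kind f e = emap subsets_kind f e'\<rbrakk> \<Longrightarrow> e = e'"
    by (simp add: subsets_kind_def inj_on_image_eq_iff)
  show "supp subsets_kind e \<subseteq> f ` S \<Longrightarrow>
      \<exists>e'. supp subsets_kind e' \<subseteq> S \<and> emap subsets_kind f e' = e"
    by (auto simp: subsets_kind_def subset_image_iff)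
qed

interpretation tuples: kind_laws tuples_kind
proof
  fix f :: "'a \<Rightarrow> 'a" and S e e'
  show "supp tuples_kind (emap tuples_kind f e) = f ` supp tuples_kind e"
    by (simp add: tuples_kind_def)
  show "\<lbrakk>inj_on f S; supp tuples_kind e \<subseteq> S; supp tuples_kind e' \<subseteq> S;
      emap tuples_kind f e = emap tuples_kind f e'\<rbrakk> \<Longrightarrow> e = e'"
    by (auto simp: tuples_kind_def intro: map_inj_on inj_on_subset)
  show "\<exists>e'. supp tuples_kind e' \<subseteq> S \<and> emap tuples_kind f e' = e"
    if "supp tuples_kind e \<subseteq> f ` S"
  proof (intro exI conjI)
    show "supp tuples_kind (map (inv_into S f) e) \<subseteq> S"
      using that by (auto simp: tuples_kind_def inv_into_into)
    show "emap tuples_kind f (map (inv_into S f) e) = e"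
      using that by (auto simp: tuples_kind_def f_inv_into_f intro!: map_idI)
  qed
qed

lemma (in kind_laws) delta_embedding:
  assumes "embedding K f B N" "Y \<subseteq> univ B"
  shows "delta K N (f ` Y) = delta K B Y"
proof -
  have inj: "inj_on f Y"
    using assms by (auto simp: embedding_def intro: inj_on_subset)
  let ?F = "\<lambda>(i, e). (i, emap K f e)"
  have "?F ` edges K B Y = edges K N (f ` Y)"
  proof (intro equalityI subsetI)
    fix x assume "x \<in> ?F ` edges K B Y"
    then obtain i e where "x = (i, emap K f e)" "e \<in> rels B i" "supp K e \<subseteq> Y"
      by (auto simp: edges_def)
    then show "x \<in> edges K N (f ` Y)"
      using assms by (fastforce simp: embedding_def mem_edges supp_emap)
  next
    fix x assume "x \<in> edges K N (f ` Y)"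
    then obtain i e where x: "x = (i, e)" "e \<in> rels N i" "supp K e \<subseteq> f ` Y"
      by (auto simp: edges_def)
    then obtain e' where e': "supp K e' \<subseteq> Y" "emap K f e' = e"
      using emap_surj by blast
    then have "e' \<in> rels B i"
      using assms x by (auto simp: embedding_def)
    with e' x show "x \<in> ?F ` edges K B Y"
      by (intro image_eqI[of _ _ "(i, e')"]) (auto simp: mem_edges)
  qed
  moreover have "inj_on ?F (edges K B Y)"
    using emap_inj[OF inj] by (auto simp: inj_on_def edges_def)
  ultimately have "card (edges K N (f ` Y)) = card (edges K B Y)"
    by (metis card_image)
  then show ?thesis
    by (simp add: delta_def card_image[OF inj])
qed

definition fits :: "('a, 'e) kind \<Rightarrow> nat \<Rightarrow> nat \<Rightarrow> bool" where
  "fits K n k \<longleftrightarrow> (\<forall>X. finite X \<and> card X = k \<longrightarrow> (\<exists>e. legal K n e \<and> supp K e = X))"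

lemma fits_subsets_kind: "fits subsets_kind n n"
  by (simp add: fits_def subsets_kind_def)

lemma fits_tuples_kind:
  assumes "0 < k" "k \<le> n"
  shows "fits tuples_kind n k"
  unfolding fits_def
proof (intro allI impI)
  fix X :: "'a set" assume X: "finite X \<and> card X = k"
  then obtain xs where xs: "set xs = X" "length xs = k"
    by (metis finite_distinct_list distinct_card)
  then have "hd xs \<in> X"
    using assms(1) by (auto intro: hd_in_set)
  then have "legal tuples_kind n (xs @ replicate (n - k) (hd xs))
    \<and> supp tuples_kind (xs @ replicate (n - k) (hd xs)) = X"
    using assms(2) xs by (auto simp: tuples_kind_def)
  then show "\<exists>e. legal tuples_kind n e \<and> supp tuples_kind e = X"
    by blast
qed

definition attach ::
  "('a, 'e) kind \<Rightarrow> ('a, 'i, 'e) lstruct \<Rightarrow> 'a set \<Rightarrow> 'a set \<Rightarrow> ('i \<times> 'e) set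
    \<Rightarrow> ('a, 'i, 'e) lstruct" where
  "attach K N A C J = \<lparr>univ = C, rels = (\<lambda>i. {e. (i, e) \<in> edges K N A \<union> J})\<rparr>"

lemma univ_attach: "univ (attach K N A C J) = C"
  by (simp add: attach_def)

lemma edges_attach:
  "edges K (attach K N A C J) Y = edges K N (Y \<inter> A) \<union> {j \<in> J. supp K (snd j) \<subseteq> Y}"
  by (auto simp: edges_def attach_def)

locale strong_attachment = kind_laws K
  for K :: "('a::infinite, 'e) kind" +
  fixes ar :: "'i \<Rightarrow> nat" and N :: "('a, 'i, 'e) lstruct" and A C :: "'a set"
    and J :: "('i \<times> 'e) set"
  assumes generic: "generic K ar N" and strong_A: "strong_in K N A"
    and finite_C: "finite C" and A_subset_C: "A \<subseteq> C" and finite_J: "finite J"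
    and legal_J: "(i, e) \<in> J \<Longrightarrow> legal K (ar i) e"
    and supp_J: "j \<in> J \<Longrightarrow> supp K (snd j) \<subseteq> C \<and> \<not> supp K (snd j) \<subseteq> A"
    and strong_J: "strong_extension C A (\<lambda>j. supp K (snd j)) J"
begin

abbreviation B :: "('a, 'i, 'e) lstruct" where
  "B \<equiv> attach K N A C J"

lemma nonneg_predim_N: "nonneg_predim K N"
  using generic by (rule generic_nonneg_predim)

lemma finite_old_edges: "finite (edges K N (Y \<inter> A))"
  using nonneg_predim_N strong_in_finite[OF strong_A] strong_in_univ[OF strong_A]
  by (intro finite_edges) auto

lemma delta_attach:
  assumes "Y \<subseteq> C"
  shows "delta K B Y = ext_delta A (delta K N) (\<lambda>j. supp K (snd j)) J Y"
  using assms finite_C finite_J finite_old_edges supp_J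
  by (intro delta_eq_ext_delta edges_attach) (auto intro: finite_subset)

lemma nonneg_predim_attach: "nonneg_predim K B"
  unfolding nonneg_predim_def univ_attach
proof (intro allI impI conjI)
  fix Y assume Y: "Y \<subseteq> C" "finite Y"
  show "finite (edges K B Y)"
    using finite_old_edges finite_J by (simp add: edges_attach)
  have "0 \<le> delta K N (Y \<inter> A)"
    using nonneg_predim_N Y(2) strong_in_univ[OF strong_A]
    by (intro delta_nonneg) auto
  also have "\<dots> \<le> delta K B Y"
    unfolding delta_attach[OF Y(1)]
    by (rule ext_delta_ge_base[OF strong_J A_subset_C finite_J Y(1)])
  finally show "0 \<le> delta K B Y" .
qed

lemma in_class_attach: "in_class K ar B"
proof -
  have "is_lstruct K ar B"
    using generic_legal[OF generic] legal_J supp_J A_subset_C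
    by (fastforce simp: is_lstruct_def attach_def edges_def)
  then show ?thesis
    using finite_C nonneg_predim_attach by (simp add: in_class_iff univ_attach)
qed

lemma strong_sub_attach: "strong_sub K (induced K N A) B"
proof -
  have "induced K N A = induced K B A"
    using supp_J by (force simp: induced_def attach_def edges_def)
  moreover have "strong_in K B A"
    unfolding strong_in_def univ_attach
  proof (intro conjI allI impI)
    fix Y assume Y: "finite Y \<and> A \<subseteq> Y \<and> Y \<subseteq> C"
    have "delta K B A = delta K N A"
      using supp_J by (simp add: delta_attach[OF A_subset_C] ext_delta_base)
    then show "delta K B A \<le> delta K B Y"
      using ext_delta_ge_base[OF strong_J A_subset_C finite_J, of Y "delta K N"] Y
      by (simp add: delta_attach Int_absorb1)
  qed (use A_subset_C finite_C finite_subset in auto)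
  ultimately show ?thesis
    using A_subset_C
      self_sufficient_iff_strong_in[OF nonneg_predim_attach strong_in_finite[OF strong_A]]
    by (simp add: strong_sub_def substruct_def univ_attach) (simp add: induced_def)
qed

lemma generic_attach:
  obtains f where "inj_on f C" "\<And>a. a \<in> A \<Longrightarrow> f a = a" "strong_in K N (f ` C)"
    "\<And>Y. Y \<subseteq> C \<Longrightarrow> delta K N (f ` Y) = ext_delta A (delta K N) (\<lambda>j. supp K (snd j)) J Y"
proof -
  have univ_A: "univ (induced K N A) = A"
    by (simp add: induced_def)
  have "strong_sub K (induced K N A) N"
    using strong_A strong_in_univ[OF strong_A]
      self_sufficient_iff_strong_in[OF nonneg_predim_N strong_in_finite[OF strong_A]]
    by (simp add: strong_sub_def substruct_def univ_A)
  then obtain f where f: "embedding K f B N" "\<And>a. a \<in> A \<Longrightarrow> f a = a"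
    "self_sufficient K (f ` C) N"
    using strong_in_finite[OF strong_A]
      generic_embedding[OF generic _ _ in_class_attach strong_sub_attach,
        unfolded univ_A univ_attach]
    by blast
  show ?thesis
  proof
    show "inj_on f C"
      using f(1) by (simp add: embedding_def univ_attach)
    show "strong_in K N (f ` C)"
      using f(3) finite_C self_sufficient_iff_strong_in[OF nonneg_predim_N] by simp
    show "delta K N (f ` Y) = ext_delta A (delta K N) (\<lambda>j. supp K (snd j)) J Y" if "Y \<subseteq> C" for Y
      using delta_embedding[OF f(1)] delta_attach[OF that] that by (simp add: univ_attach)
  qed (rule f(2))
qed

end

lemma exists_fresh_injection:
  assumes "finite I" "finite U"
  shows "\<exists>x :: 'i \<Rightarrow> 'a::infinite. inj_on x I \<and> x ` I \<subseteq> - U"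
proof -
  have "infinite (- U)"
    using assms(2) by (simp add: Compl_eq_Diff_UNIV Diff_infinite_finite infinite_UNIV)
  then obtain T where "T \<subseteq> - U" "finite T" "card T = card I"
    by (metis infinite_arbitrarily_large)
  then show ?thesis
    using inj_on_iff_card_le[OF assms(1), of T] by auto
qed

lemma exists_injection_extension:
  assumes "finite V" "W \<subseteq> V" "inj_on n W"
  obtains g :: "'v \<Rightarrow> 'a::infinite" where "inj_on g V" "\<And>w. w \<in> W \<Longrightarrow> g w = n w"
proof -
  have "finite W"
    using assms finite_subset by blast
  then obtain x :: "'v \<Rightarrow> 'a" where x: "inj_on x (V - W)" "x ` (V - W) \<subseteq> - n ` W"
    using exists_fresh_injection[of "V - W" "n ` W"] assms(1) by auto
  let ?g = "\<lambda>v. if v \<in> W then n v else x v"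
  have "inj_on ?g (W \<union> (V - W))"
    using assms(3) x by (intro inj_on_disjoint_Un) auto
  then have "inj_on ?g V"
    using assms(2) by (simp add: Un_absorb1)
  then show ?thesis
    by (rule that) simp
qed

lemma (in edge_extension) exists_instances:
  assumes "inj_on g V" and fits: "\<And>j. j \<in> J \<Longrightarrow> fits K (n j) (card (s j))"
    and "inj_on (\<lambda>j. (symb j, s j)) J"
  obtains E where "\<And>j. j \<in> J \<Longrightarrow> legal K (n j) (E j)"
    "\<And>j. j \<in> J \<Longrightarrow> supp K (E j) = g ` s j" "inj_on (\<lambda>j. (symb j, E j)) J"
proof -
  have "\<exists>e. legal K (n j) e \<and> supp K e = g ` s j" if "j \<in> J" for j
    using fits[OF that] finite_subset[OF supp_subset_V[OF that] finite_V]
      card_image[OF inj_on_subset[OF assms(1) supp_subset_V[OF that]]]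
    by (simp add: fits_def)
  then obtain E where E: "\<And>j. j \<in> J \<Longrightarrow> legal K (n j) (E j)"
    "\<And>j. j \<in> J \<Longrightarrow> supp K (E j) = g ` s j"
    by metis
  have "inj_on (\<lambda>j. (symb j, E j)) J"
  proof (rule inj_onI)
    fix j j' assume j: "j \<in> J" "j' \<in> J" and eq: "(symb j, E j) = (symb j', E j')"
    have "g ` s j = g ` s j'"
      using E(2)[OF j(1)] E(2)[OF j(2)] eq by simp
    then have "s j = s j'"
      using inj_on_image_eq_iff[OF assms(1)] supp_subset_V j by simp
    then show "j = j'"
      using inj_onD[OF assms(3) _ j] eq by simp
  qed
  with E show ?thesis
    by (rule that)
qed

lemma (in kind_laws) generic_extend_along_injection:
  fixes N :: "('a, 'i, 'e) lstruct" and symb :: "'j \<Rightarrow> 'i"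
  assumes "edge_extension V W s J"
    and gen: "generic K ar N" and g: "inj_on g V" "strong_in K N (g ` W)"
    and edges: "\<And>j. j \<in> J \<Longrightarrow> fits K (ar (symb j)) (card (s j))"
      "inj_on (\<lambda>j. (symb j, s j)) J" "strong_extension V W s J"
  obtains h where "inj_on h V" "\<And>w. w \<in> W \<Longrightarrow> h w = g w" "strong_in K N (h ` V)"
    "\<And>Y. Y \<subseteq> V \<Longrightarrow> delta K N (h ` Y) = ext_delta W (\<lambda>X. delta K N (g ` X)) s J Y"
proof -
  interpret edge_extension V W s J by fact
  obtain E where E: "\<And>j. j \<in> J \<Longrightarrow> legal K (ar (symb j)) (E j)"
    "\<And>j. j \<in> J \<Longrightarrow> supp K (E j) = g ` s j" and inst: "inj_on (\<lambda>j. (symb j, E j)) J"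
    using exists_instances[of g K "\<lambda>j. ar (symb j)" symb] g(1) edges(1,2) by blast
  let ?inst = "\<lambda>j. (symb j, E j)"
  have "strong_extension (g ` V) (g ` W) (\<lambda>j. supp K (snd j)) (?inst ` J)"
    using supp_subset_V E(2)
    by (intro strong_extension_image[OF edges(3) W_subset_V finite_J g(1) inst]) simp
  moreover have "supp K (E j) \<subseteq> g ` V \<and> \<not> supp K (E j) \<subseteq> g ` W" if "j \<in> J" for j
    using supp_subset_V[OF that] supp_not_subset_W[OF that] W_subset_V
    by (simp add: E(2)[OF that] inj_on_image_subset_iff[OF g(1)] image_mono)
  ultimately interpret strong_attachment K ar N "g ` W" "g ` V" "?inst ` J"
    using gen g(2) finite_V finite_J E(1) image_mono[OF W_subset_V, of g]
    by unfold_locales (auto, blast)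
  obtain f where f: "inj_on f (g ` V)" "\<And>a. a \<in> g ` W \<Longrightarrow> f a = a" "strong_in K N (f ` g ` V)"
    "\<And>Y. Y \<subseteq> g ` V \<Longrightarrow> delta K N (f ` Y)
      = ext_delta (g ` W) (delta K N) (\<lambda>j. supp K (snd j)) (?inst ` J) Y"
    by (rule generic_attach) blast
  show ?thesis
  proof
    show "inj_on (f \<circ> g) V"
      using g(1) f(1) by (rule comp_inj_on)
    show "(f \<circ> g) w = g w" if "w \<in> W" for w
      using f(2) that by simp
    show "strong_in K N ((f \<circ> g) ` V)"
      using f(3) by (simp add: image_comp)
    fix Y assume Y: "Y \<subseteq> V"
    have "delta K N ((f \<circ> g) ` Y)
        = ext_delta (g ` W) (delta K N) (\<lambda>j. supp K (snd j)) (?inst ` J) (g ` Y)"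
      using f(4)[OF image_mono[OF Y]] by (simp add: image_comp)
    also have "\<dots> = ext_delta W (\<lambda>X. delta K N (g ` X)) s J Y"
      using supp_subset_V E(2) by (intro ext_delta_image[OF g(1) W_subset_V Y inst]) simp
    finally show "delta K N ((f \<circ> g) ` Y) = ext_delta W (\<lambda>X. delta K N (g ` X)) s J Y" .
  qed
qed

lemma (in kind_laws) generic_extend:
  fixes N :: "('a, 'i, 'e) lstruct" and symb :: "'j \<Rightarrow> 'i"
  assumes "edge_extension V W s J"
    and gen: "generic K ar N" and n: "inj_on n W" "strong_in K N (n ` W)"
    and edges: "\<And>j. j \<in> J \<Longrightarrow> fits K (ar (symb j)) (card (s j))"
      "inj_on (\<lambda>j. (symb j, s j)) J" "strong_extension V W s J"
  obtains h where "inj_on h V" "\<And>w. w \<in> W \<Longrightarrow> h w = n w" "strong_in K N (h ` V)"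
    "\<And>Y. Y \<subseteq> V \<Longrightarrow> delta K N (h ` Y) = ext_delta W (\<lambda>X. delta K N (n ` X)) s J Y"
proof -
  interpret edge_extension V W s J by fact
  obtain g where g: "inj_on g V" "\<And>w. w \<in> W \<Longrightarrow> g w = n w"
    using exists_injection_extension[OF finite_V W_subset_V n(1)] by blast
  have g_eq_n: "g ` X = n ` X" if "X \<subseteq> W" for X
    using that g(2) by (intro image_cong) auto
  have base: "ext_delta W (\<lambda>X. delta K N (g ` X)) s J = ext_delta W (\<lambda>X. delta K N (n ` X)) s J"
    by (intro ext_delta_cong_base) (simp add: g_eq_n)
  have "strong_in K N (g ` W)"
    using n(2) g_eq_n by simp
  then obtain h where "inj_on h V" "\<And>w. w \<in> W \<Longrightarrow> h w = g w" "strong_in K N (h ` V)"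
    "\<And>Y. Y \<subseteq> V \<Longrightarrow> delta K N (h ` Y) = ext_delta W (\<lambda>X. delta K N (g ` X)) s J Y"
    using generic_extend_along_injection[OF assms(1) gen g(1) _ edges] by blast
  then show ?thesis
    using g(2) by (intro that[of h]) (simp_all add: base)
qed

section \<open>Replacing tuples by sets\<close>

text \<open>
  The tuple \<open>e\<close> of arity \<open>n e\<close> has support \<open>S e\<close>, and \<open>c e\<close> is a point of \<open>S e\<close> outside the base.
  Besides the edge \<open>Original e\<close> we use \<open>n e + 1\<close> fresh points \<open>x (Loop e k)\<close> of dimension \<open>0\<close> and
  a fresh point \<open>x (Parallel e)\<close> that has the same closure as \<open>c e\<close>. Tuples with repetitions can
  force this directly. Sets of size \<open>n e\<close> force it as well: the loops carry all \<open>n e\<close>-element sets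
  of loops, and loops pad the other sets. Trading \<open>c e\<close> for the parallel point in \<open>Original e\<close>
  keeps the sets distinct, even if \<open>S e\<close> leaves no room for padding and supports several tuples.
\<close>

datatype 't gadget_edge = Loop 't nat | Parallel 't | Original 't

primrec origin :: "'t gadget_edge \<Rightarrow> 't" where
  "origin (Loop e k) = e"
| "origin (Parallel e) = e"
| "origin (Original e) = e"

definition auxiliary_edges :: "'t set \<Rightarrow> ('t \<Rightarrow> nat) \<Rightarrow> 't gadget_edge set" where
  "auxiliary_edges T n = {Loop e k | e k. e \<in> T \<and> k \<le> n e} \<union> Parallel ` T"

lemma finite_auxiliary_edges:
  assumes "finite T"
  shows "finite (auxiliary_edges T n)"
proof -
  have "{Loop e k | e k. e \<in> T \<and> k \<le> n e} = (\<lambda>(e, k). Loop e k) ` (SIGMA e:T. {..n e})"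
    by auto
  then show ?thesis
    using assms by (simp add: auxiliary_edges_def)
qed

locale gadget =
  fixes T :: "'t set" and n :: "'t \<Rightarrow> nat" and S :: "'t \<Rightarrow> 'v set" and c :: "'t \<Rightarrow> 'v"
    and B W :: "'v set" and x :: "'t gadget_edge \<Rightarrow> 'v"
  assumes finite_T: "finite T" and finite_B: "finite B" and W_subset_B: "W \<subseteq> B"
    and S_subset_B: "e \<in> T \<Longrightarrow> S e \<subseteq> B" and c_in_S: "e \<in> T \<Longrightarrow> c e \<in> S e"
    and c_notin_W: "e \<in> T \<Longrightarrow> c e \<notin> W" and card_S_le: "e \<in> T \<Longrightarrow> card (S e) \<le> n e"
    and n_ge_3: "e \<in> T \<Longrightarrow> 3 \<le> n e"
    and inj_x: "inj_on x (auxiliary_edges T n)" and fresh_x: "x ` auxiliary_edges T n \<subseteq> - B"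
begin

abbreviation new_edges :: "'t gadget_edge set" where
  "new_edges \<equiv> auxiliary_edges T n"

definition all_edges :: "'t gadget_edge set" where
  "all_edges = Original ` T \<union> new_edges"

definition verts :: "'v set" where
  "verts = B \<union> x ` new_edges"

primrec tuple_supp :: "'t gadget_edge \<Rightarrow> 'v set" where
  "tuple_supp (Loop e k) = {x (Loop e k)}"
| "tuple_supp (Parallel e) = {x (Parallel e), c e}"
| "tuple_supp (Original e) = S e"

primrec old_part :: "'t gadget_edge \<Rightarrow> 'v set" where
  "old_part (Loop e k) = {}"
| "old_part (Parallel e) = {c e}"
| "old_part (Original e) = S e - {c e}"

primrec new_part :: "'t gadget_edge \<Rightarrow> 't gadget_edge set" where
  "new_part (Loop e k) = Loop e ` ({..n e} - {k})"
| "new_part (Parallel e) = insert (Parallel e) (Loop e ` {..<n e - 2})"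
| "new_part (Original e) = insert (Parallel e) (Loop e ` {..<n e - card (S e)})"

definition set_supp :: "'t gadget_edge \<Rightarrow> 'v set" where
  "set_supp j = old_part j \<union> x ` new_part j"

lemma mem_new_edges [simp]:
  "Loop e k \<in> new_edges \<longleftrightarrow> e \<in> T \<and> k \<le> n e"
  "Parallel e \<in> new_edges \<longleftrightarrow> e \<in> T"
  "Original e \<notin> new_edges"
  by (auto simp: auxiliary_edges_def)

lemma mem_all_edges [simp]:
  "Loop e k \<in> all_edges \<longleftrightarrow> e \<in> T \<and> k \<le> n e"
  "Parallel e \<in> all_edges \<longleftrightarrow> e \<in> T"
  "Original e \<in> all_edges \<longleftrightarrow> e \<in> T"
  by (auto simp: all_edges_def)

lemma finite_S: "e \<in> T \<Longrightarrow> finite (S e)"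
  using S_subset_B finite_B finite_subset by blast

lemma c_in_B: "e \<in> T \<Longrightarrow> c e \<in> B"
  using S_subset_B c_in_S by blast

lemma finite_all_edges: "finite all_edges"
  using finite_T by (simp add: all_edges_def finite_auxiliary_edges)

lemma finite_verts: "finite verts"
  using finite_B finite_T by (simp add: verts_def finite_auxiliary_edges)

lemma x_in_verts_Diff_B: "j \<in> new_edges \<Longrightarrow> x j \<in> verts - B"
  using fresh_x by (auto simp: verts_def)

lemma tuple_supp_subset_verts: "j \<in> all_edges \<Longrightarrow> tuple_supp j \<subseteq> verts"
  using S_subset_B c_in_B by (cases j) (auto simp: verts_def)

lemma x_in_tuple_supp: "j \<in> new_edges \<Longrightarrow> x j \<in> tuple_supp j"
  by (cases j) simp_all

lemma old_part_subset_B: "j \<in> all_edges \<Longrightarrow> old_part j \<subseteq> B"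
  using S_subset_B c_in_B by (cases j) auto

lemma new_part_subset_new_edges: "j \<in> all_edges \<Longrightarrow> new_part j \<subseteq> new_edges"
  by (cases j) auto

lemma new_part_nonempty:
  assumes "j \<in> all_edges"
  shows "new_part j \<noteq> {}"
proof (cases j)
  case (Loop e k)
  then have "{0, 1} \<subseteq> {..n e}"
    using assms n_ge_3[of e] by auto
  then have "{..n e} - {k} \<noteq> {}"
    by auto
  then show ?thesis
    by (simp add: Loop)
qed simp_all

lemma set_supp_Int_B: "j \<in> all_edges \<Longrightarrow> set_supp j \<inter> B = old_part j"
  using old_part_subset_B new_part_subset_new_edges fresh_x by (fastforce simp: set_supp_def)

lemma set_supp_Diff_B: "j \<in> all_edges \<Longrightarrow> set_supp j - B = x ` new_part j"
  using old_part_subset_B new_part_subset_new_edges fresh_x by (fastforce simp: set_supp_def)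

lemma set_supp_subset_verts: "j \<in> all_edges \<Longrightarrow> set_supp j \<subseteq> verts"
  unfolding set_supp_def verts_def using old_part_subset_B new_part_subset_new_edges by blast

lemma set_supp_not_subset_B: "j \<in> all_edges \<Longrightarrow> \<not> set_supp j \<subseteq> B"
  using set_supp_Diff_B new_part_nonempty by (metis Diff_eq_empty_iff image_is_empty)

lemma card_set_supp:
  assumes "j \<in> all_edges"
  shows "card (set_supp j) = n (origin j)"
proof -
  have finite: "finite (old_part j)" "finite (new_part j)"
    using assms finite_S by (cases j; simp)+
  have "card (set_supp j) = card (old_part j) + card (x ` new_part j)"
    unfolding set_supp_def
    using finite set_supp_Int_B[OF assms] set_supp_Diff_B[OF assms]
    by (intro card_Un_disjoint) blast+
  also have "card (x ` new_part j) = card (new_part j)"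
    by (intro card_image inj_on_subset[OF inj_x] new_part_subset_new_edges assms)
  also have "card (old_part j) + card (new_part j) = n (origin j)"
  proof (cases j)
    case (Loop e k)
    then show ?thesis
      using assms by (simp add: card_image inj_on_def)
  next
    case (Parallel e)
    then show ?thesis
      using assms n_ge_3[of e] by (simp add: card_image inj_on_def image_iff)
  next
    case (Original e)
    then have "card (S e) \<noteq> 0"
      using assms finite_S c_in_S by auto
    then show ?thesis
      using assms c_in_S[of e] card_S_le[of e] Original
      by (simp add: card_image inj_on_def image_iff)
  qed
  finally show ?thesis .
qed

lemma inj_on_set_supp: "inj_on set_supp all_edges"
proof (rule inj_onI)
  fix j j' assume j: "j \<in> all_edges" "j' \<in> all_edges" and eq: "set_supp j = set_supp j'"
  have old: "old_part j = old_part j'"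
    using eq set_supp_Int_B[OF j(1)] set_supp_Int_B[OF j(2)] by simp
  have "x ` new_part j = x ` new_part j'"
    using eq set_supp_Diff_B[OF j(1)] set_supp_Diff_B[OF j(2)] by simp
  then have new: "new_part j = new_part j'"
    using inj_on_image_eq_iff[OF inj_x] new_part_subset_new_edges j by simp
  show "j = j'"
  proof (cases j)
    case (Loop e k)
    obtain l where "Loop e l \<in> new_part j'"
      using new_part_nonempty[OF j(1)] new by (auto simp: Loop)
    moreover have "Parallel f \<notin> new_part j'" for f
      using new by (auto simp: Loop)
    ultimately obtain k' where Loop': "j' = Loop e k'"
      by (cases j') auto
    have "Loop e k \<notin> new_part j'"
      using new by (auto simp: Loop)
    then show ?thesis
      using j by (auto simp: Loop Loop')
  next
    case (Parallel e)
    then have "Parallel e \<in> new_part j'" "c e \<in> old_part j'"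
      using old new by auto
    then show ?thesis
      by (cases j') (auto simp: Parallel)
  next
    case (Original e)
    then have "Parallel e \<in> new_part j'" "c e \<notin> old_part j'"
      using old new by auto
    then show ?thesis
      by (cases j') (auto simp: Original)
  qed
qed

lemma edge_extension_tuple_supp: "edge_extension verts B tuple_supp new_edges"
proof
  show "tuple_supp j \<subseteq> verts" if "j \<in> new_edges" for j
    using that tuple_supp_subset_verts by (simp add: all_edges_def)
  show "\<not> tuple_supp j \<subseteq> B" if "j \<in> new_edges" for j
    using that x_in_tuple_supp x_in_verts_Diff_B by blast
qed (use finite_verts finite_T in \<open>auto simp: verts_def finite_auxiliary_edges\<close>)

lemma strong_extension_tuple_supp: "strong_extension verts B tuple_supp new_edges"
  unfolding strong_extension_def
proof (intro allI impI)
  fix Y assume Y: "B \<subseteq> Y \<and> Y \<subseteq> verts"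
  have "card {j \<in> new_edges. tuple_supp j \<subseteq> Y} = card (x ` {j \<in> new_edges. tuple_supp j \<subseteq> Y})"
    by (intro card_image[symmetric] inj_on_subset[OF inj_x]) auto
  also have "\<dots> \<le> card (Y - B)"
    using Y finite_verts finite_subset x_in_tuple_supp x_in_verts_Diff_B by (intro card_mono) blast+
  finally show "card {j \<in> new_edges. tuple_supp j \<subseteq> Y} \<le> card (Y - B)" .
qed

lemma inj_on_tuple_supp: "inj_on tuple_supp new_edges"
proof (rule inj_onI)
  fix j j' assume j: "j \<in> new_edges" "j' \<in> new_edges" and eq: "tuple_supp j = tuple_supp j'"
  have "tuple_supp j' \<subseteq> insert (x j') B"
    using j(2) c_in_B by (cases j') auto
  then have "x j = x j'"
    using x_in_tuple_supp[OF j(1)] x_in_verts_Diff_B[OF j(1)] eq by auto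
  then show "j = j'"
    using inj_x j by (simp add: inj_on_eq_iff)
qed

lemma card_tuple_supp:
  assumes "j \<in> new_edges"
  shows "0 < card (tuple_supp j)" "card (tuple_supp j) \<le> n (origin j)"
  using assms n_ge_3 by (cases j; force simp: card_insert_if)+

lemma edge_extension_set_supp: "edge_extension verts W set_supp all_edges"
proof
  show "\<not> set_supp j \<subseteq> W" if "j \<in> all_edges" for j
    using set_supp_not_subset_B[OF that] W_subset_B by blast
qed (use finite_verts W_subset_B finite_all_edges set_supp_subset_verts in \<open>auto simp: verts_def\<close>)

lemma ext_delta_tuple_supp:
  assumes "Y \<subseteq> verts"
  shows "ext_delta B (ext_delta W \<alpha> S T) tuple_supp new_edges Y
    = ext_delta W \<alpha> tuple_supp all_edges Y"
proof -
  have "ext_delta W \<alpha> tuple_supp (Original ` T) = ext_delta W \<alpha> S T"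
    by (simp add: ext_delta_image_edges inj_on_def)
  moreover have "ext_delta B (ext_delta W \<alpha> tuple_supp (Original ` T)) tuple_supp new_edges Y
      = ext_delta W \<alpha> tuple_supp (Original ` T \<union> new_edges) Y"
    using assms finite_verts finite_subset finite_T W_subset_B S_subset_B
    by (intro ext_delta_trans) (auto simp: finite_auxiliary_edges dest: subsetD[OF S_subset_B])
  ultimately show ?thesis
    by (simp add: all_edges_def)
qed

definition gadget_closed :: "'v set \<Rightarrow> bool" where
  "gadget_closed Z \<longleftrightarrow>
    (\<forall>e\<in>T. (\<forall>k\<le>n e. x (Loop e k) \<in> Z) \<and> (x (Parallel e) \<in> Z \<longleftrightarrow> c e \<in> Z))"

lemma tuple_supp_subset_iff_set_supp_subset:
  assumes "gadget_closed Z" "j \<in> all_edges"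
  shows "tuple_supp j \<subseteq> Z \<longleftrightarrow> set_supp j \<subseteq> Z"
proof (cases j)
  case (Original e)
  have "S e \<subseteq> Z \<longleftrightarrow> S e - {c e} \<subseteq> Z \<and> x (Parallel e) \<in> Z"
    using assms c_in_S by (auto simp: Original gadget_closed_def)
  then show ?thesis
    using assms by (auto simp: Original set_supp_def gadget_closed_def)
qed (use assms in \<open>auto simp: set_supp_def gadget_closed_def\<close>)

lemma gadget_closed_if_saturated_tuple_supp:
  assumes sat: "saturated verts (ext_delta W \<alpha> tuple_supp all_edges) Z"
  shows "gadget_closed Z"
proof -
  note mem = saturated_memI[OF sat finite_verts finite_all_edges]
  have "x (Loop e k) \<in> Z" if "e \<in> T" "k \<le> n e" for e k
    using that x_in_verts_Diff_B[of "Loop e k"] W_subset_B by (intro mem[where j = "Loop e k"]) auto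
  moreover have "x (Parallel e) \<in> Z" if "e \<in> T" "c e \<in> Z" for e
    using that x_in_verts_Diff_B[of "Parallel e"] W_subset_B
    by (intro mem[where j = "Parallel e"]) auto
  moreover have "c e \<in> Z" if "e \<in> T" "x (Parallel e) \<in> Z" for e
    using that c_in_B[of e] c_notin_W[of e]
    by (intro mem[where j = "Parallel e"]) (auto simp: verts_def)
  ultimately show ?thesis
    by (auto simp: gadget_closed_def)
qed

lemma gadget_closed_if_saturated_set_supp:
  assumes sat: "saturated verts (ext_delta W \<alpha> set_supp all_edges) Z"
  shows "gadget_closed Z"
proof -
  note mem = saturated_memI[OF sat finite_verts finite_all_edges]
  have "(\<lambda>k. x (Loop e k)) ` {..n e} \<subseteq> Z" if e: "e \<in> T" for e
  proof (rule saturated_image_subset[OF sat finite_verts _ finite_all_edges])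
    \<comment> \<open>the loop \<open>k\<close> is charged to the set that omits its cyclic successor\<close>
    let ?next = "\<lambda>k. if k = n e then 0 else Suc k"
    show "(\<lambda>k. x (Loop e k)) ` {..n e} \<subseteq> verts - W"
      using e x_in_verts_Diff_B[of "Loop e _"] W_subset_B by auto
    show "inj_on (\<lambda>k. Loop e (?next k)) {..n e}"
      by (auto simp: inj_on_def split: if_splits)
    show "Loop e (?next k) \<in> all_edges \<and> x (Loop e k) \<in> set_supp (Loop e (?next k))
        \<and> set_supp (Loop e (?next k)) \<subseteq> Z \<union> (\<lambda>k. x (Loop e k)) ` {..n e}"
      if "k \<in> {..n e}" for k
      using that e n_ge_3[OF e] by (auto simp: set_supp_def)
  qed simp
  then have loop: "x (Loop e k) \<in> Z" if "e \<in> T" "k \<le> n e" for e k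
    using that by auto
  moreover have "x (Parallel e) \<in> Z" if "e \<in> T" "c e \<in> Z" for e
    using that x_in_verts_Diff_B[of "Parallel e"] W_subset_B loop[OF that(1)]
    by (intro mem[where j = "Parallel e"]) (auto simp: set_supp_def)
  moreover have "c e \<in> Z" if "e \<in> T" "x (Parallel e) \<in> Z" for e
    using that c_in_B[of e] c_notin_W[of e] loop[OF that(1)]
    by (intro mem[where j = "Parallel e"]) (auto simp: verts_def set_supp_def)
  ultimately show ?thesis
    by (auto simp: gadget_closed_def)
qed

lemma dim_on_tuple_supp_eq_set_supp:
  "dim_on verts (ext_delta W \<alpha> tuple_supp all_edges)
    = dim_on verts (ext_delta W \<alpha> set_supp all_edges)"
  using finite_verts
proof (rule dim_on_ext_delta_eq_if_saturated)
  fix Z j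
  assume "saturated verts (ext_delta W \<alpha> tuple_supp all_edges) Z
    \<or> saturated verts (ext_delta W \<alpha> set_supp all_edges) Z"
  then have "gadget_closed Z"
    using gadget_closed_if_saturated_tuple_supp gadget_closed_if_saturated_set_supp by blast
  then show "j \<in> all_edges \<Longrightarrow> tuple_supp j \<subseteq> Z \<longleftrightarrow> set_supp j \<subseteq> Z"
    by (rule tuple_supp_subset_iff_set_supp_subset)
qed

end

section \<open>Back and forth\<close>

lemma exists_chain_meeting_demands:
  assumes D: "countable D" and start: "P R0"
    and step: "\<And>R d. P R \<Longrightarrow> d \<in> D \<Longrightarrow> \<exists>R'. R \<subseteq> R' \<and> P R' \<and> meets R' d"
  obtains R :: "nat \<Rightarrow> 'c set" where "mono R" "\<And>k. P (R k)" "\<And>d. d \<in> D \<Longrightarrow> \<exists>k. meets (R k) d"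
proof -
  let ?d = "from_nat_into D"
  have "\<exists>R. \<forall>k. P (R k) \<and> R k \<subseteq> R (Suc k) \<and> (?d k \<in> D \<longrightarrow> meets (R (Suc k)) (?d k))"
  proof (rule dependent_nat_choice)
    show "\<exists>R. P R"
      using start by blast
    show "\<exists>R'. P R' \<and> R \<subseteq> R' \<and> (?d k \<in> D \<longrightarrow> meets R' (?d k))" if "P R" for R k
      using that step[OF that, of "?d k"] by (cases "?d k \<in> D") auto
  qed
  then obtain R where R: "\<And>k. P (R k)" "\<And>k. R k \<subseteq> R (Suc k)"
    "\<And>k. ?d k \<in> D \<Longrightarrow> meets (R (Suc k)) (?d k)"
    by blast
  have "\<exists>k. meets (R k) d" if "d \<in> D" for d
    using from_nat_into_surj[OF D that] R(3) that by blast
  then show ?thesis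
    using R(1,2) by (intro that[of R] incseq_SucI)
qed

lemma finite_subset_UN_mono:
  fixes R :: "nat \<Rightarrow> 'c set"
  assumes "mono R" "finite Q" "Q \<subseteq> (\<Union>k. R k)"
  obtains k where "Q \<subseteq> R k"
proof -
  have "R k \<subseteq> R l \<or> R l \<subseteq> R k" for k l
    using assms(1) by (meson monoD nat_le_linear)
  then have "subset.chain UNIV (range R)"
    by (auto simp: subset_chain_def)
  then show ?thesis
    using finite_subset_Union_chain[OF assms(2,3)] that by blast
qed

lemma single_valued_UN_mono:
  fixes R :: "nat \<Rightarrow> ('a \<times> 'b) set"
  assumes "mono R" "\<And>k. single_valued (R k)"
  shows "single_valued (\<Union>k. R k)"
proof (rule single_valuedI)
  fix x y z assume "(x, y) \<in> (\<Union>k. R k)" "(x, z) \<in> (\<Union>k. R k)"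
  then have "{(x, y), (x, z)} \<subseteq> (\<Union>k. R k)"
    by simp
  then obtain k where "{(x, y), (x, z)} \<subseteq> R k"
    by (rule finite_subset_UN_mono[OF assms(1), rotated]) simp_all
  then show "y = z"
    using assms(2)[of k] by (auto dest: single_valuedD)
qed

lemma single_valued_eq_graph:
  assumes "single_valued R"
  obtains n where "R = (\<lambda>x. (x, n x)) ` Domain R"
proof -
  obtain n where "\<forall>x\<in>Domain R. (x, n x) \<in> R"
    using bchoice[of "Domain R" "\<lambda>x y. (x, y) \<in> R"] by blast
  then have "R = (\<lambda>x. (x, n x)) ` Domain R"
    using assms by (force dest: single_valuedD)
  then show ?thesis
    by (rule that)
qed

lemma bij_betw_of_single_valued:
  assumes "single_valued G" "single_valued (G\<inverse>)"
  obtains F where "bij_betw F (Domain G) (Range G)" "\<And>x y. (x, y) \<in> G \<Longrightarrow> F x = y"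
proof -
  obtain F where G: "G = (\<lambda>x. (x, F x)) ` Domain G"
    using assms(1) by (rule single_valued_eq_graph)
  then have F: "F x = y" if "(x, y) \<in> G" for x y
    using that by (metis (no_types, lifting) imageE prod.inject)
  have "inj_on F (Domain G)"
    using assms(2) F by (auto simp: inj_on_def single_valued_def)
  moreover have "F ` Domain G = Range G"
    using F by force
  ultimately show ?thesis
    using F by (intro that[of F]) (simp_all add: bij_betw_def)
qed

lemma back_and_forth:
  assumes countable: "countable U" "countable U'"
    and start: "P R0"
    and P: "\<And>R. P R \<Longrightarrow> Domain R \<subseteq> U \<and> Range R \<subseteq> U' \<and> single_valued R \<and> single_valued (R\<inverse>)"
    and forward: "\<And>R a. P R \<Longrightarrow> a \<in> U \<Longrightarrow> \<exists>R'. R \<subseteq> R' \<and> P R' \<and> a \<in> Domain R'"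
    and backward: "\<And>R b. P R \<Longrightarrow> b \<in> U' \<Longrightarrow> \<exists>R'. R \<subseteq> R' \<and> P R' \<and> b \<in> Range R'"
  obtains F where "bij_betw F U U'"
    "\<And>X. finite X \<Longrightarrow> X \<subseteq> U \<Longrightarrow> \<exists>R. P R \<and> (\<lambda>x. (x, F x)) ` X \<subseteq> R"
proof -
  define meets where "meets R d = (case d of Inl a \<Rightarrow> a \<in> Domain R | Inr b \<Rightarrow> b \<in> Range R)"
    for R :: "('a \<times> 'b) set" and d
  have "countable (U <+> U')"
    using countable by simp
  then obtain R :: "nat \<Rightarrow> ('a \<times> 'b) set" where "mono R" and R: "\<And>k. P (R k)"
    and meets: "\<And>d. d \<in> U <+> U' \<Longrightarrow> \<exists>k. meets (R k) d"
  proof (rule exists_chain_meeting_demands[where P = P and meets = meets])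
    show "\<exists>R'. R \<subseteq> R' \<and> P R' \<and> meets R' d" if "P R" "d \<in> U <+> U'" for R d
      using that forward backward by (auto simp: meets_def)
  qed (use start in simp_all)
  let ?G = "\<Union>k. R k"
  have "single_valued ?G"
    using \<open>mono R\<close> P[OF R] by (simp add: single_valued_UN_mono)
  moreover have "single_valued (?G\<inverse>)"
    unfolding converse_UNION
    using \<open>mono R\<close> P[OF R] by (intro single_valued_UN_mono) (auto simp: mono_def)
  ultimately obtain F where F: "bij_betw F (Domain ?G) (Range ?G)" "\<And>x y. (x, y) \<in> ?G \<Longrightarrow> F x = y"
    using bij_betw_of_single_valued by blast
  have "a \<in> Domain ?G" if "a \<in> U" for a
    using meets[of "Inl a"] that by (auto simp: meets_def)
  moreover have "b \<in> Range ?G" if "b \<in> U'" for b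
    using meets[of "Inr b"] that by (auto simp: meets_def)
  ultimately have G: "Domain ?G = U" "Range ?G = U'"
    using P[OF R] by blast+
  show ?thesis
  proof
    show "bij_betw F U U'"
      using F(1) by (simp only: G)
    fix X assume X: "finite X" "X \<subseteq> U"
    have "(\<lambda>x. (x, F x)) ` X \<subseteq> ?G"
      using X(2) F(2) by (force simp flip: G(1))
    then obtain k where "(\<lambda>x. (x, F x)) ` X \<subseteq> R k"
      using finite_subset_UN_mono[OF \<open>mono R\<close> finite_imageI[OF X(1)]] by blast
    then show "\<exists>R. P R \<and> (\<lambda>x. (x, F x)) ` X \<subseteq> R"
      using R by blast
  qed
qed

section \<open>Dimension-preserving partial bijections\<close>

definition partial_iso ::
  "('a, 'e) kind \<Rightarrow> ('a, 'i, 'e) lstruct \<Rightarrow> ('b, 'f) kind \<Rightarrow> ('b, 'j, 'f) lstruct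
    \<Rightarrow> ('a \<times> 'b) set \<Rightarrow> bool" where
  "partial_iso K M L N R \<longleftrightarrow>
    single_valued R \<and> single_valued (R\<inverse>) \<and>
    strong_in K M (Domain R) \<and> strong_in L N (Range R) \<and>
    (\<forall>Q\<subseteq>R. dim K M (Domain Q) = dim L N (Range Q))"

lemma partial_iso_empty:
  assumes "nonneg_predim K M" "nonneg_predim L N"
  shows "partial_iso K M L N {}"
  unfolding partial_iso_def
  by (simp add: assms strong_in_empty dim_empty)

lemma partial_iso_converse:
  assumes "partial_iso K M L N R"
  shows "partial_iso L N K M (R\<inverse>)"
proof -
  have "dim L N (Domain Q) = dim K M (Range Q)" if "Q \<subseteq> R\<inverse>" for Q
  proof -
    have "Q\<inverse> \<subseteq> R"
      using that by auto
    then have "dim K M (Domain (Q\<inverse>)) = dim L N (Range (Q\<inverse>))"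
      using assms unfolding partial_iso_def by blast
    then show ?thesis by simp
  qed
  then show ?thesis
    using assms by (simp add: partial_iso_def)
qed

lemma partial_iso_graph_iff:
  assumes "inj_on m V"
  shows "partial_iso K M L N ((\<lambda>v. (m v, n v)) ` V) \<longleftrightarrow>
    inj_on n V \<and> strong_in K M (m ` V) \<and> strong_in L N (n ` V) \<and>
    (\<forall>X\<subseteq>V. dim K M (m ` X) = dim L N (n ` X))"
proof -
  let ?graph = "\<lambda>X. (\<lambda>v. (m v, n v)) ` X"
  have graph: "Domain (?graph X) = m ` X" "Range (?graph X) = n ` X" for X
    by (auto simp: Domain_fst Range_snd image_image)
  have "single_valued (?graph V)"
    using assms by (auto simp: single_valued_def inj_on_def)
  moreover have "single_valued ((?graph V)\<inverse>) \<longleftrightarrow> (\<forall>v\<in>V. \<forall>w\<in>V. n v = n w \<longrightarrow> m v = m w)"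
    by (simp add: single_valued_def image_iff) metis
  then have "single_valued ((?graph V)\<inverse>) \<longleftrightarrow> inj_on n V"
    using assms by (auto simp: inj_on_def)
  moreover have "(\<forall>Q\<subseteq>?graph V. dim K M (Domain Q) = dim L N (Range Q)) \<longleftrightarrow>
    (\<forall>X\<subseteq>V. dim K M (m ` X) = dim L N (n ` X))"
    by (simp add: all_subset_image graph)
  ultimately show ?thesis
    by (simp add: partial_iso_def graph)
qed

lemma partial_iso_graphE:
  assumes "partial_iso K M L N R" and nonneg: "nonneg_predim K M" "nonneg_predim L N"
  obtains n where "R = (\<lambda>x. (x, n x)) ` Domain R" "inj_on n (Domain R)"
    "strong_in L N (n ` Domain R)"
    "dim_on (Domain R) (delta K M) = dim_on (Domain R) (\<lambda>X. delta L N (n ` X))"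
proof -
  obtain n where R: "R = (\<lambda>x. (x, n x)) ` Domain R"
    using assms(1) by (auto simp: partial_iso_def elim: single_valued_eq_graph)
  then have n: "inj_on n (Domain R)" "strong_in L N (n ` Domain R)"
    and dim: "\<forall>X\<subseteq>Domain R. dim K M X = dim L N (n ` X)"
    using assms(1) partial_iso_graph_iff[of "\<lambda>x. x" "Domain R" K M L N n] by simp_all
  have "strong_in K M (Domain R)"
    using assms(1) by (simp add: partial_iso_def)
  then have "dim_on (Domain R) (delta K M) = dim_on (Domain R) (\<lambda>X. delta L N (n ` X))"
    using dim_on_delta_eq_iff[OF nonneg, of "\<lambda>x. x" "Domain R" n] n(2) dim
    by (simp add: strong_in_finite)
  with R n show ?thesis
    by (rule that)
qed

lemma (in kind_laws) partial_iso_extend: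
  fixes N :: "('a, 'i, 'e) lstruct" and symb :: "'j \<Rightarrow> 'i"
  assumes nonneg_M: "nonneg_predim K' M" and gen: "generic K ar N"
    and iso: "partial_iso K' M K N R"
    and m: "inj_on m V" "strong_in K' M (m ` V)" "\<And>x. x \<in> Domain R \<Longrightarrow> m x = x"
    and ext: "edge_extension V (Domain R) s J"
    and edges: "\<And>j. j \<in> J \<Longrightarrow> fits K (ar (symb j)) (card (s j))" "inj_on (\<lambda>j. (symb j, s j)) J"
    and dim: "dim_on V (\<lambda>X. delta K' M (m ` X)) = dim_on V (ext_delta (Domain R) (delta K' M) s J)"
  shows "\<exists>R'. R \<subseteq> R' \<and> partial_iso K' M K N R' \<and> Domain R' = m ` V"
proof -
  interpret edge_extension V "Domain R" s J by fact
  have nonneg_N: "nonneg_predim K N"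
    using gen by (rule generic_nonneg_predim)
  have strong_R: "strong_in K' M (Domain R)"
    using iso by (simp add: partial_iso_def)
  obtain n where R: "R = (\<lambda>x. (x, n x)) ` Domain R" and n: "inj_on n (Domain R)"
    "strong_in K N (n ` Domain R)"
    and base: "dim_on (Domain R) (delta K' M) = dim_on (Domain R) (\<lambda>X. delta K N (n ` X))"
    by (rule partial_iso_graphE[OF iso nonneg_M nonneg_N])
  have "delta K' M (Domain R) \<le> delta K' M (m ` Z)" if Z: "Domain R \<subseteq> Z" "Z \<subseteq> V" for Z
  proof (rule delta_le_if_strong_in[OF strong_R])
    show "finite (m ` Z)"
      using finite_subset[OF Z(2) finite_V] by simp
    show "Domain R \<subseteq> m ` Z"
      using Z(1) m(3) by force
    show "m ` Z \<subseteq> univ M"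
      using image_mono[OF Z(2)] strong_in_univ[OF m(2)] by (rule order_trans)
  qed
  then have "strong_extension V (Domain R) s J"
    by (rule strong_extension_if_dim_on_eq[OF finite_V dim])
  then obtain n' where n': "inj_on n' V" "\<And>x. x \<in> Domain R \<Longrightarrow> n' x = n x" "strong_in K N (n' ` V)"
    and delta: "\<And>Y. Y \<subseteq> V \<Longrightarrow>
      delta K N (n' ` Y) = ext_delta (Domain R) (\<lambda>X. delta K N (n ` X)) s J Y"
    using generic_extend[OF ext gen n edges] by blast
  have "dim_on V (\<lambda>X. delta K' M (m ` X)) = dim_on V (ext_delta (Domain R) (delta K' M) s J)"
    by (rule dim)
  also have "\<dots> = dim_on V (ext_delta (Domain R) (\<lambda>X. delta K N (n ` X)) s J)"
    by (rule dim_on_ext_delta_cong[OF finite_V W_subset_V finite_J base])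
  also have "\<dots> = dim_on V (\<lambda>X. delta K N (n' ` X))"
    by (rule dim_on_cong) (simp add: delta)
  finally have "\<forall>X\<subseteq>V. dim K' M (m ` X) = dim K N (n' ` X)"
    by (simp add: dim_on_delta_eq_iff[OF nonneg_M nonneg_N m(2) n'(3) finite_V])
  then have "partial_iso K' M K N ((\<lambda>v. (m v, n' v)) ` V)"
    using m n' by (simp add: partial_iso_graph_iff)
  moreover have "R \<subseteq> (\<lambda>v. (m v, n' v)) ` V"
    using n'(2) m(3) W_subset_V by (subst R) force
  moreover have "Domain ((\<lambda>v. (m v, n' v)) ` V) = m ` V"
    by (simp add: Domain_fst image_image)
  ultimately show ?thesis
    by blast
qed

lemma partial_iso_forth:
  fixes M :: "('a::infinite, 'i, 'a set) lstruct" and N :: "('b::infinite, 'i, 'b list) lstruct"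
  assumes ar: "\<And>i. 0 < ar i"
    and genM: "generic subsets_kind ar M" and genN: "generic tuples_kind ar N"
    and iso: "partial_iso subsets_kind M tuples_kind N R" and a: "a \<in> univ M"
  shows "\<exists>R'. R \<subseteq> R' \<and> partial_iso subsets_kind M tuples_kind N R' \<and> a \<in> Domain R'"
proof -
  let ?K = "subsets_kind :: ('a, 'a set) kind" and ?L = "tuples_kind :: ('b, 'b list) kind"
  let ?s = "\<lambda>j :: 'i \<times> 'a set. supp ?K (snd j)"
  have nonneg_M: "nonneg_predim ?K M"
    using genM by (rule generic_nonneg_predim)
  have R: "strong_in ?K M (Domain R)"
    using iso by (simp add: partial_iso_def)
  then have "finite (insert a (Domain R))" "insert a (Domain R) \<subseteq> univ M"
    using a by (simp_all add: strong_in_def)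
  then obtain B where B: "strong_in ?K M B" and R_a_B: "insert a (Domain R) \<subseteq> B"
    by (rule exists_strong_in_superset[OF nonneg_M])
  let ?J = "edges ?K M B - edges ?K M (Domain R)"
  note B_props = strong_in_finite[OF B] strong_in_univ[OF B]
  have "\<exists>R'. R \<subseteq> R' \<and> partial_iso ?K M ?L N R' \<and> Domain R' = (\<lambda>x. x) ` B"
  proof (rule tuples.partial_iso_extend[where s = ?s and J = ?J and symb = fst,
        OF nonneg_M genN iso])
    show "edge_extension B (Domain R) ?s ?J"
      using nonneg_M B_props R_a_B by (intro edge_extension_edges) simp_all
    show "fits ?L (ar (fst j)) (card (?s j))" if "j \<in> ?J" for j
    proof (rule fits_tuples_kind)
      have "card (?s j) = ar (fst j)"
        using that generic_legal[OF genM] by (auto simp: edges_def subsets_kind_def)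
      then show "0 < card (?s j)" "card (?s j) \<le> ar (fst j)"
        by (simp_all add: ar)
    qed
    show "inj_on (\<lambda>j. (fst j, ?s j)) ?J"
      by (auto simp: inj_on_def subsets_kind_def)
    show "dim_on B (\<lambda>X. delta ?K M ((\<lambda>x. x) ` X))
        = dim_on B (ext_delta (Domain R) (delta ?K M) ?s ?J)"
      using delta_eq_ext_delta_subset[OF nonneg_M B_props, of "Domain R"] R_a_B
      by (intro dim_on_cong) simp
  qed (use B in simp_all)
  then show ?thesis
    using R_a_B by auto
qed

lemma exists_gadget:
  fixes N :: "('b::infinite, 'i, 'b list) lstruct"
  assumes ar: "\<And>i. 3 \<le> ar i" and gen: "generic tuples_kind ar N"
    and B: "strong_in tuples_kind N B" and A: "A \<subseteq> B"
  obtains c x where "gadget (edges tuples_kind N B - edges tuples_kind N A) (\<lambda>e. ar (fst e))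
    (\<lambda>e. supp tuples_kind (snd e)) c B A x"
proof -
  let ?L = "tuples_kind :: ('b, 'b list) kind"
  let ?T = "edges ?L N B - edges ?L N A" and ?S = "\<lambda>e :: 'i \<times> 'b list. supp ?L (snd e)"
  have fin: "finite B" "finite ?T"
    using strong_in_finite[OF B] strong_in_univ[OF B] finite_edges[OF generic_nonneg_predim[OF gen]]
    by simp_all
  have "\<forall>e\<in>?T. \<exists>v. v \<in> ?S e - A"
    by (auto simp: edges_def)
  then obtain c where c: "\<forall>e\<in>?T. c e \<in> ?S e - A"
    by (rule bchoice[THEN exE])
  obtain x :: "('i \<times> 'b list) gadget_edge \<Rightarrow> 'b"
    where x: "inj_on x (auxiliary_edges ?T (\<lambda>e. ar (fst e)))"
      "x ` auxiliary_edges ?T (\<lambda>e. ar (fst e)) \<subseteq> - B"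
    using exists_fresh_injection[OF finite_auxiliary_edges[OF fin(2)] fin(1)] by blast
  have "card (?S e) \<le> ar (fst e)" if "e \<in> ?T" for e
  proof -
    have "length (snd e) = ar (fst e)"
      using that generic_legal[OF gen] by (auto simp: edges_def tuples_kind_def)
    then show ?thesis
      using card_length[of "snd e"] by (simp add: tuples_kind_def)
  qed
  then have "gadget ?T (\<lambda>e. ar (fst e)) ?S c B A x"
    using ar fin A c x by unfold_locales (auto simp: edges_def)
  then show ?thesis
    by (rule that)
qed

lemma generic_tuples_set_presentation:
  fixes N :: "('b::infinite, 'i, 'b list) lstruct"
  assumes ar: "\<And>i. 3 \<le> ar i" and gen: "generic tuples_kind ar N"
    and B: "strong_in tuples_kind N B" and A: "A \<subseteq> B"
  obtains V h and s :: "('i \<times> 'b list) gadget_edge \<Rightarrow> 'b set" and J and symb :: "_ \<Rightarrow> 'i"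
  where "inj_on h V" "strong_in tuples_kind N (h ` V)" "B \<subseteq> V" "\<And>v. v \<in> B \<Longrightarrow> h v = v"
    and "edge_extension V A s J" "\<And>j. j \<in> J \<Longrightarrow> card (s j) = ar (symb j)"
      "inj_on (\<lambda>j. (symb j, s j)) J"
    and "dim_on V (\<lambda>X. delta tuples_kind N (h ` X))
      = dim_on V (ext_delta A (delta tuples_kind N) s J)"
proof -
  let ?L = "tuples_kind :: ('b, 'b list) kind"
  let ?T = "edges ?L N B - edges ?L N A" and ?S = "\<lambda>e :: 'i \<times> 'b list. supp ?L (snd e)"
  let ?symb = "\<lambda>j :: ('i \<times> 'b list) gadget_edge. fst (origin j)"
  have nonneg_N: "nonneg_predim ?L N"
    using gen by (rule generic_nonneg_predim)
  obtain c x where "gadget ?T (\<lambda>e. ar (fst e)) ?S c B A x"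
    by (rule exists_gadget[OF assms])
  then interpret gadget ?T "\<lambda>e. ar (fst e)" ?S c B A x .
  have "fits ?L (ar (?symb j)) (card (tuple_supp j))" if "j \<in> new_edges" for j
    using card_tuple_supp[OF that] by (intro fits_tuples_kind)
  moreover have "inj_on (\<lambda>j. (?symb j, tuple_supp j)) new_edges"
    using inj_on_tuple_supp by (auto simp: inj_on_def)
  ultimately obtain h where h: "inj_on h verts" "\<And>v. v \<in> B \<Longrightarrow> h v = v" "strong_in ?L N (h ` verts)"
    and delta_h: "\<And>Y. Y \<subseteq> verts \<Longrightarrow>
      delta ?L N (h ` Y) = ext_delta B (delta ?L N) tuple_supp new_edges Y"
    using tuples.generic_extend[OF edge_extension_tuple_supp gen, of "\<lambda>v. v" ?symb]
      strong_extension_tuple_supp B by auto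
  have B_ext: "ext_delta B (delta ?L N) tuple_supp new_edges
      = ext_delta B (ext_delta A (delta ?L N) ?S ?T) tuple_supp new_edges"
    using delta_eq_ext_delta_subset[OF nonneg_N strong_in_finite[OF B] strong_in_univ[OF B] A]
    by (intro ext_delta_cong_base)
  have "dim_on verts (\<lambda>X. delta ?L N (h ` X))
      = dim_on verts (ext_delta A (delta ?L N) tuple_supp all_edges)"
    by (intro dim_on_cong) (simp add: delta_h B_ext ext_delta_tuple_supp)
  then have "dim_on verts (\<lambda>X. delta ?L N (h ` X))
      = dim_on verts (ext_delta A (delta ?L N) set_supp all_edges)"
    by (simp add: dim_on_tuple_supp_eq_set_supp)
  moreover have "inj_on (\<lambda>j. (?symb j, set_supp j)) all_edges"
    using inj_on_set_supp by (auto simp: inj_on_def)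
  ultimately show ?thesis
    using h edge_extension_set_supp card_set_supp
    by (intro that[of h verts set_supp all_edges ?symb]) (auto simp: verts_def)
qed

lemma partial_iso_back:
  fixes M :: "('a::infinite, 'i, 'a set) lstruct" and N :: "('b::infinite, 'i, 'b list) lstruct"
  assumes ar: "\<And>i. 3 \<le> ar i"
    and genM: "generic subsets_kind ar M" and genN: "generic tuples_kind ar N"
    and iso: "partial_iso subsets_kind M tuples_kind N R" and b: "b \<in> univ N"
  shows "\<exists>R'. R \<subseteq> R' \<and> partial_iso subsets_kind M tuples_kind N R' \<and> b \<in> Range R'"
proof -
  let ?K = "subsets_kind :: ('a, 'a set) kind" and ?L = "tuples_kind :: ('b, 'b list) kind"
  have nonneg_N: "nonneg_predim ?L N"
    using genN by (rule generic_nonneg_predim)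
  have "finite (insert b (Range R))" "insert b (Range R) \<subseteq> univ N"
    using iso b by (simp_all add: partial_iso_def strong_in_def)
  then obtain B where B: "strong_in ?L N B" and R_b_B: "insert b (Range R) \<subseteq> B"
    by (rule exists_strong_in_superset[OF nonneg_N])
  obtain V h and s :: "('i \<times> 'b list) gadget_edge \<Rightarrow> 'b set" and J and symb :: "_ \<Rightarrow> 'i"
    where h: "inj_on h V" "strong_in ?L N (h ` V)" "B \<subseteq> V" "\<And>v. v \<in> B \<Longrightarrow> h v = v"
      and ext: "edge_extension V (Range R) s J"
      and edges: "\<And>j. j \<in> J \<Longrightarrow> card (s j) = ar (symb j)" "inj_on (\<lambda>j. (symb j, s j)) J"
      and dim: "dim_on V (\<lambda>X. delta ?L N (h ` X)) = dim_on V (ext_delta (Range R) (delta ?L N) s J)"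
    by (rule generic_tuples_set_presentation[OF ar genN B, of "Range R"]) (use R_b_B in simp, blast)
  have "\<exists>R'. R\<inverse> \<subseteq> R' \<and> partial_iso ?L N ?K M R' \<and> Domain R' = h ` V"
  proof (rule subsets.partial_iso_extend[OF nonneg_N genM partial_iso_converse[OF iso] h(1,2)])
    show "fits ?K (ar (symb j)) (card (s j))" if "j \<in> J" for j
      by (simp add: edges(1)[OF that] fits_subsets_kind)
  qed (use h(4) R_b_B ext edges(2) dim in auto)
  then obtain R' where R': "R\<inverse> \<subseteq> R'" "partial_iso ?L N ?K M R'" "Domain R' = h ` V"
    by blast
  have "b = h b" "b \<in> V"
    using R_b_B h(3,4) by auto
  then have "b \<in> Range (R'\<inverse>)"
    using R'(3) by (metis Range_converse imageI)
  moreover have "R \<subseteq> R'\<inverse>"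
    using R'(1) by auto
  ultimately show ?thesis
    using partial_iso_converse[OF R'(2)] by blast
qed

section \<open>From dimensions to geometries\<close>

lemma cl_subset_univ: "cl K M X \<subseteq> univ M"
  by (auto simp: cl_def cl_fin_def)

lemma geom_points_subset_univ: "p \<in> geom_points K M \<Longrightarrow> p \<subseteq> univ M"
  using cl_subset_univ[of K M] by (auto simp: geom_points_def)

locale dim_preserving_bijection =
  fixes K :: "('a, 'e) kind" and M :: "('a, 'i, 'e) lstruct"
    and L :: "('b, 'f) kind" and N :: "('b, 'j, 'f) lstruct" and F :: "'a \<Rightarrow> 'b"
  assumes bij: "bij_betw F (univ M) (univ N)"
    and dim_image: "\<lbrakk>finite X; X \<subseteq> univ M\<rbrakk> \<Longrightarrow> dim L N (F ` X) = dim K M X"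
begin

lemma inj: "inj_on F (univ M)"
  using bij by (simp add: bij_betw_def)

lemma surj: "F ` univ M = univ N"
  using bij by (simp add: bij_betw_def)

lemma cl_fin_image:
  assumes X: "finite X" "X \<subseteq> univ M"
  shows "cl_fin L N (F ` X) = F ` cl_fin K M X"
proof -
  have "dim L N (insert (F c) (F ` X)) = dim K M (insert c X)" if "c \<in> univ M" for c
    using dim_image[of "insert c X"] X that by simp
  then show ?thesis
    using dim_image[OF X] by (auto simp: cl_fin_def simp flip: surj)
qed

lemma cl_image:
  assumes X: "X \<subseteq> univ M"
  shows "cl L N (F ` X) = F ` cl K M X"
proof (cases "finite X")
  case True
  then show ?thesis
    using X by (simp add: cl_def cl_fin_image)
next
  case False
  then have "infinite (F ` X)"
    using inj_on_subset[OF inj X] by (simp add: finite_image_iff)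
  have "cl L N (F ` X) = (\<Union>Y\<in>{Y. finite Y \<and> Y \<subseteq> F ` X}. cl_fin L N Y)"
    using \<open>infinite (F ` X)\<close> by (simp add: cl_def)
  also have "\<dots> = (\<Union>Y\<in>{Y. finite Y \<and> Y \<subseteq> X}. cl_fin L N (F ` Y))"
    using ex_finite_subset_image[of F X] by (auto simp: set_eq_iff)
  also have "\<dots> = (\<Union>Y\<in>{Y. finite Y \<and> Y \<subseteq> X}. F ` cl_fin K M Y)"
    using X by (intro SUP_cong refl cl_fin_image) auto
  finally show ?thesis
    using False by (simp add: cl_def image_UN)
qed

lemma geom_points_image: "geom_points L N = (`) F ` geom_points K M"
proof -
  have point: "cl L N {F x} - cl L N {} = F ` (cl K M {x} - cl K M {})" if "x \<in> univ M" for x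
    using cl_image[of "{x}"] cl_image[of "{}"] that cl_subset_univ[of K M]
    by (simp add: inj_on_image_set_diff[OF inj] Diff_subset[THEN order_trans])
  have loop: "F x \<in> cl L N {} \<longleftrightarrow> x \<in> cl K M {}" if "x \<in> univ M" for x
    using cl_image[of "{}"] that by (simp add: inj_on_image_mem_iff[OF inj] cl_subset_univ)
  have "geom_points L N
      = (\<lambda>x. cl L N {F x} - cl L N {}) ` {x \<in> univ M. F x \<notin> cl L N {}}"
    by (auto simp: geom_points_def simp flip: surj)
  also have "\<dots> = (\<lambda>x. F ` (cl K M {x} - cl K M {})) ` {x \<in> univ M. x \<notin> cl K M {}}"
    using point loop by (intro image_cong) auto
  also have "\<dots> = (`) F ` geom_points K M"
    by (auto simp: geom_points_def)
  finally show ?thesis .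
qed

lemma geom_clos_image:
  assumes "P \<subseteq> geom_points K M"
  shows "(`) F ` clos (geom K M) P = clos (geom L N) ((`) F ` P)"
proof -
  have "\<Union>P \<subseteq> univ M"
    using assms geom_points_subset_univ by blast
  then have "cl L N (F ` \<Union>P) = F ` cl K M (\<Union>P)"
    by (rule cl_image)
  moreover have "F ` p \<subseteq> F ` cl K M (\<Union>P) \<longleftrightarrow> p \<subseteq> cl K M (\<Union>P)" if "p \<in> geom_points K M" for p
    using inj geom_points_subset_univ[OF that] cl_subset_univ by (rule inj_on_image_subset_iff)
  ultimately show ?thesis
    by (auto simp: geom_def geom_points_image image_Union[symmetric])
qed

lemma geom_iso: "geom_iso (geom K M) (geom L N)"
proof -
  have "inj_on ((`) F) (geom_points K M)"
    by (rule inj_on_subset[OF inj_on_image_Pow[OF inj]]) (auto dest: geom_points_subset_univ)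
  then have "bij_betw ((`) F) (points (geom K M)) (points (geom L N))"
    by (simp add: bij_betw_def geom_def geom_points_image)
  moreover have "\<forall>P\<subseteq>points (geom K M). (`) F ` clos (geom K M) P = clos (geom L N) ((`) F ` P)"
    using geom_clos_image by (simp add: geom_def)
  ultimately show ?thesis
    unfolding geom_iso_def by blast
qed

end

lemma exists_dim_preserving_bijection:
  fixes M :: "('a::infinite, 'i, 'a set) lstruct" and N :: "('b::infinite, 'i, 'b list) lstruct"
  assumes ar: "\<And>i. 3 \<le> ar i"
    and genM: "generic subsets_kind ar M" and genN: "generic tuples_kind ar N"
  shows "\<exists>F. dim_preserving_bijection subsets_kind M tuples_kind N F"
proof -
  let ?iso = "partial_iso subsets_kind M tuples_kind N"
  have ar_pos: "0 < ar i" for i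
    using ar[of i] by simp
  obtain F where F: "bij_betw F (univ M) (univ N)"
    and local_iso: "\<And>X. finite X \<Longrightarrow> X \<subseteq> univ M \<Longrightarrow> \<exists>R. ?iso R \<and> (\<lambda>x. (x, F x)) ` X \<subseteq> R"
  proof (rule back_and_forth[where P = ?iso])
    show "countable (univ M)" "countable (univ N)"
      using genM genN by (simp_all add: generic_def)
    show "?iso {}"
      using genM genN by (intro partial_iso_empty generic_nonneg_predim)
    show "Domain R \<subseteq> univ M \<and> Range R \<subseteq> univ N \<and> single_valued R \<and> single_valued (R\<inverse>)"
      if "?iso R" for R
      using that by (simp add: partial_iso_def strong_in_def)
    show "\<exists>R'. R \<subseteq> R' \<and> ?iso R' \<and> a \<in> Domain R'" if "?iso R" "a \<in> univ M" for R a
      using ar_pos genM genN that by (rule partial_iso_forth)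
    show "\<exists>R'. R \<subseteq> R' \<and> ?iso R' \<and> b \<in> Range R'" if "?iso R" "b \<in> univ N" for R b
      using ar genM genN that by (rule partial_iso_back)
  qed blast
  have "dim tuples_kind N (F ` X) = dim subsets_kind M X" if X: "finite X" "X \<subseteq> univ M" for X
  proof -
    let ?graph = "(\<lambda>x. (x, F x)) ` X"
    obtain R where "?iso R" "?graph \<subseteq> R"
      using local_iso[OF X] by blast
    then have "dim subsets_kind M (Domain ?graph) = dim tuples_kind N (Range ?graph)"
      by (simp add: partial_iso_def)
    then show ?thesis
      by (simp add: Domain_fst Range_snd image_image)
  qed
  with F have "dim_preserving_bijection subsets_kind M tuples_kind N F"
    by unfold_locales
  then show ?thesis
    by blast
qed

theorem theorem4p7:
  fixes ar :: "'i \<Rightarrow> nat"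
    and M :: "('a::infinite, 'i, 'a set) lstruct"
    and M_hat :: "('b::infinite, 'i, 'b list) lstruct"
  assumes "\<forall>i. 3 \<le> ar i"
    and "\<forall>k. finite {i. ar i = k}"
    and "generic subsets_kind ar M"
    and "generic tuples_kind ar M_hat"
  shows "geom_iso (geom subsets_kind M) (geom tuples_kind M_hat)"
proof -
  obtain F where "dim_preserving_bijection subsets_kind M tuples_kind M_hat F"
    using exists_dim_preserving_bijection[of ar, OF _ assms(3,4)] assms(1) by blast
  then show ?thesis
    by (rule dim_preserving_bijection.geom_iso)
qed

end
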